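(* Let $G$ be a graph on $n$ vertices, and let $e(G)$ denote its number of edges. Then the following hold. (a) If $G$ is connected and has no forest cut, then $e(G) \geq \frac{9}{4}n - \frac{15}{4}$. (b) If $G$ is $3$-connected, $1$-cyclic, and $n \geq 6$, then $e(G) \geq \frac{15}{8}n$. (c) If $G$ is $3$-connected, $2$-cyclic, and $n \geq 6$, then $e(G) \geq 2n$.
   Context: Graphs are finite and simple. For a connected graph $G$, a set $S \subset V(G)$ is a vertex cut if $G-S$ is disconnected (so it has at least two connected components). A forest cut is a vertex cut $S$ such that the induced subgraph $G[S]$ is a forest (i.e. acyclic). For a set $S \subseteq V(G)$, its neighborhood $N(S)$ is the set of vertices of $V(G)\setminus S$ having at least one neighbor in $S$; $S$ is dominating if every vertex of $V(G)\setminus S$ has a neighbor in $S$, i.e. $N(S) = V(G)\setminus S$. For a positive integer $k$, a graph is $k$-cyclic if every nonempty vertex set $S$ of size at most $k$ is dominating or has a cycle in its neighborhood, i.e. the induced subgraph $G[N(S)]$ contains a cycle. *)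

theory Defs
  imports Complex_Main "Graph_Theory.Graph_Theory"
begin

(* A finite simple graph is an instance of the locale graph: a finite symmetric loopless digraph
   without parallel arcs. Each undirected edge uv is present as the two arcs (u,v) and (v,u). *)

definition uedges :: "('a, 'b) pre_digraph \<Rightarrow> 'a set set" where
  "uedges G = {{u, v} | u v. u \<rightarrow>\<^bsub>G\<^esub> v}"

(* In a symmetric digraph the closed walk u,v,u satisfies pre_digraph.cycle, so the library
   predicate forest fails as soon as there is an edge. Undirected cycles have length at least 3. *)
definition has_ucycle :: "('a, 'b) pre_digraph \<Rightarrow> bool" where
  "has_ucycle G \<longleftrightarrow> (\<exists>p. pre_digraph.cycle G p \<and> 3 \<le> length p)"

definition uforest :: "('a, 'b) pre_digraph \<Rightarrow> bool" where
  "uforest G \<longleftrightarrow> \<not> has_ucycle G"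

(* Digraph_Component.connected is false for the null graph. Since S is a proper subset of the
   vertex set, G - S is not null and has at least two components. *)
definition vertex_cut :: "('a, 'b) pre_digraph \<Rightarrow> 'a set \<Rightarrow> bool" where
  "vertex_cut G S \<longleftrightarrow>
     S \<subset> verts G \<and> \<not> Digraph_Component.connected (G \<restriction> (verts G - S))"

definition forest_cut :: "('a, 'b) pre_digraph \<Rightarrow> 'a set \<Rightarrow> bool" where
  "forest_cut G S \<longleftrightarrow> vertex_cut G S \<and> uforest (G \<restriction> S)"

definition neighborhood :: "('a, 'b) pre_digraph \<Rightarrow> 'a set \<Rightarrow> 'a set" where
  "neighborhood G S = {v \<in> verts G - S. \<exists>u\<in>S. v \<rightarrow>\<^bsub>G\<^esub> u}"

definition dominating :: "('a, 'b) pre_digraph \<Rightarrow> 'a set \<Rightarrow> bool" where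
  "dominating G S \<longleftrightarrow> (\<forall>v \<in> verts G - S. \<exists>u\<in>S. v \<rightarrow>\<^bsub>G\<^esub> u)"

definition k_cyclic :: "nat \<Rightarrow> ('a, 'b) pre_digraph \<Rightarrow> bool" where
  "k_cyclic k G \<longleftrightarrow>
     (\<forall>S. S \<subseteq> verts G \<and> S \<noteq> {} \<and> card S \<le> k \<longrightarrow>
        dominating G S \<or> has_ucycle (G \<restriction> neighborhood G S))"

(* The usual convention: more than k vertices, and deleting fewer than k of them leaves a
   connected graph. In particular the complete graph on k + 1 vertices is k-connected. *)
definition k_connected :: "nat \<Rightarrow> ('a, 'b) pre_digraph \<Rightarrow> bool" where
  "k_connected k G \<longleftrightarrow> k < card (verts G) \<and>
     (\<forall>X. X \<subseteq> verts G \<and> card X < k \<longrightarrow>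
        Digraph_Component.connected (G \<restriction> (verts G - X)))"

end

theory Submission
  imports Defs
begin

text \<open>
  All three bounds compare degrees with the desired average degree and let the vertices of high
  degree pay for those of low degree (lemma \<open>discharging\<close>). The hypotheses give
  local information about small sets \<open>X\<close> of vertices: the neighbourhood of \<open>X\<close> contains a cycle, and
  in a three-connected graph it has at least three elements, provided that it does not exhaust
  the remaining vertices. Instead of a cycle the proof uses its vertex set, or any other
  \<^emph>\<open>core\<close>: a nonempty set in which every vertex has two neighbours in the set. A core with three elements
  is a triangle and one with four elements contains a triangle or spans a 4-cycle, so the local
  structure can be read off directly.

  In a three-connected 1-cyclic graph with at least six vertices the neighbourhood of a vertex
  of degree 3 is a triangle. Three-connectedness forces its neighbours to have degree at
  least 4, and a vertex of degree 4 to have at most one neighbour of degree 3. So every vertex of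
  degree 3 can collect its deficit of \<open>3/4\<close> to the average \<open>15/4\<close> by taking \<open>1/4\<close> from each
  neighbour. If the graph is 2-cyclic, at most one neighbour of a vertex of degree 3 has
  degree 4, and the deficit of 1 to the average 4 is paid by the other two or three neighbours.

  The bound for graphs without a forest cut goes by a minimal counterexample. There are local
  changes of the graph that create no forest cut and remove at least \<open>9/4\<close> edges per deleted
  vertex: delete a set of vertices whose neighbourhood is a clique (or nearly one, in the sense of
  lemma \<open>cut_cyclic_delete\<close>), and replace a vertex of degree 4 whose neighbourhood
  contains a 4-cycle by one diagonal of this cycle (lemma \<open>cut_cyclic_contract\<close>). A minimal
  counterexample admits none of them. Hence it has minimum degree 4, and thus at least 16
  vertices, since otherwise degree 4 is already enough. Moreover the neighbourhood of each vertex
  of degree 4 consists of a triangle and a fourth vertex with at most one neighbour in this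
  triangle. So each vertex of degree 4 lies in a unique \<open>K\<^sub>4\<close>. Such a \<open>K\<^sub>4\<close> contains at most two
  vertices of degree 4 (lemma \<open>not_three_low_in_K4\<close>), and its other vertices pay the missing \<open>1/2\<close>
  for each of them. The only payers that could be overcharged have degree 5 and belong to two such
  \<open>K\<^sub>4\<close>, one of which has two vertices of degree 4; lemma \<open>no_quintic_in_two_K4\<close> excludes this
  configuration by a reduction that deletes three vertices and inserts at most three edges. The degree sum
  is therefore at least \<open>9/2\<close> times the number of vertices, a contradiction.
\<close>

section \<open>Graphs as symmetric relations\<close>

text \<open>
  The relation \<open>E\<close> may also relate elements outside of \<open>V\<close>. So vertices are deleted by shrinking \<open>V\<close>
  alone.
\<close>

locale simple_graph =
  fixes V :: "'a set" and E :: "'a \<Rightarrow> 'a \<Rightarrow> bool"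
  assumes finite_V: "finite V"
    and sym: "E u v \<Longrightarrow> E v u"
    and irrefl: "\<not> E u u"

definition nbrs :: "'a set \<Rightarrow> ('a \<Rightarrow> 'a \<Rightarrow> bool) \<Rightarrow> 'a \<Rightarrow> 'a set" where
  "nbrs V E v = {u \<in> V. E v u}"

abbreviation deg :: "'a set \<Rightarrow> ('a \<Rightarrow> 'a \<Rightarrow> bool) \<Rightarrow> 'a \<Rightarrow> nat" where
  "deg V E v \<equiv> card (nbrs V E v)"

definition boundary :: "'a set \<Rightarrow> ('a \<Rightarrow> 'a \<Rightarrow> bool) \<Rightarrow> 'a set \<Rightarrow> 'a set" where
  "boundary V E X = {v \<in> V - X. \<exists>u\<in>X. E u v}"

text \<open>
  Every edge occurs as two pairs, so the number of pairs is the sum of the degrees and twice the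
  number of edges.
\<close>

definition adj_pairs :: "'a set \<Rightarrow> ('a \<Rightarrow> 'a \<Rightarrow> bool) \<Rightarrow> ('a \<times> 'a) set" where
  "adj_pairs V E = {(u, v). u \<in> V \<and> v \<in> V \<and> E u v}"

text \<open>
  The vertex set of a cycle is a core, and every finite core contains a cycle. Unlike cycles, cores
  survive the addition of edges and the replacement of a path by an edge without any bookkeeping of
  walks.
\<close>

definition core :: "('a \<Rightarrow> 'a \<Rightarrow> bool) \<Rightarrow> 'a set \<Rightarrow> bool" where
  "core E T \<longleftrightarrow> T \<noteq> {} \<and> (\<forall>t\<in>T. \<exists>x\<in>T. \<exists>y\<in>T. x \<noteq> y \<and> E t x \<and> E t y)"

text \<open>
  \<open>A\<close> and \<open>B\<close> are the two sides left by the vertex cut \<open>V - A - B\<close>; each side may consist of several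
  components.
\<close>

definition separated :: "'a set \<Rightarrow> ('a \<Rightarrow> 'a \<Rightarrow> bool) \<Rightarrow> 'a set \<Rightarrow> 'a set \<Rightarrow> bool" where
  "separated V E A B \<longleftrightarrow> A \<noteq> {} \<and> B \<noteq> {} \<and> A \<subseteq> V \<and> B \<subseteq> V \<and> A \<inter> B = {} \<and>
     (\<forall>a\<in>A. \<forall>b\<in>B. \<not> E a b)"

text \<open>
  This is the absence of a forest cut, since a finite set induces a cycle if and only if it contains a
  core.
\<close>

definition cut_cyclic :: "'a set \<Rightarrow> ('a \<Rightarrow> 'a \<Rightarrow> bool) \<Rightarrow> bool" where
  "cut_cyclic V E \<longleftrightarrow> (\<forall>A B. separated V E A B \<longrightarrow> (\<exists>T \<subseteq> V - A - B. core E T))"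

lemma core_mono: "core E T \<Longrightarrow> (\<And>u v. E u v \<Longrightarrow> E' u v) \<Longrightarrow> core E' T"
  unfolding core_def by meson

text \<open>
  Moving the charge \<open>w v u\<close> from \<open>u\<close> to \<open>v\<close> does not change the total charge. If afterwards every
  vertex has a nonnegative charge, then the original charges have a nonnegative sum.
\<close>

lemma discharging:
  fixes f :: "'a \<Rightarrow> int" and w :: "'a \<Rightarrow> 'a \<Rightarrow> int"
  assumes fin: "finite V" and L: "L \<subseteq> V"
    and receive: "\<And>v. v \<in> L \<Longrightarrow> 0 \<le> f v + (\<Sum>u\<in>V - L. w v u)"
    and pay: "\<And>u. u \<in> V - L \<Longrightarrow> (\<Sum>v\<in>L. w v u) \<le> f u"
  shows "0 \<le> sum f V"
proof -
  have "0 \<le> (\<Sum>v\<in>L. f v + (\<Sum>u\<in>V - L. w v u))"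
    using receive by (rule sum_nonneg)
  also have "\<dots> = sum f L + (\<Sum>u\<in>V - L. \<Sum>v\<in>L. w v u)"
    by (subst sum.swap) (simp add: sum.distrib)
  also have "\<dots> \<le> sum f L + sum f (V - L)"
    using pay by (intro add_left_mono sum_mono)
  also have "\<dots> = sum f V" using sum.subset_diff[OF L fin, of f] by simp
  finally show ?thesis .
qed

lemma sum_if_mem:
  fixes c :: int
  assumes "finite L" "S \<subseteq> L"
  shows "(\<Sum>v\<in>L. if v \<in> S then c else 0) = c * int (card S)"
  using assms by (simp add: sum.If_cases Int_absorb1)

context simple_graph
begin

lemma finite_nbrs [simp]: "finite (nbrs V E v)"
  using finite_V by (simp add: nbrs_def)

lemma nbrs_subset: "nbrs V E v \<subseteq> V - {v}"
  using irrefl by (auto simp: nbrs_def)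

lemma boundary_single: "boundary V E {v} = nbrs V E v"
  using irrefl by (auto simp: boundary_def nbrs_def)

lemma boundary_eq: "X \<subseteq> V \<Longrightarrow> boundary V E X = (\<Union>u\<in>X. nbrs V E u) - X"
  by (auto simp: boundary_def nbrs_def)

lemma nbrs_eqI: "S \<subseteq> nbrs V E v \<Longrightarrow> card S = deg V E v \<Longrightarrow> nbrs V E v = S"
  using card_subset_eq[OF finite_nbrs] by metis

lemma nbrs_commute: "u \<in> V \<Longrightarrow> v \<in> V \<Longrightarrow> u \<in> nbrs V E v \<longleftrightarrow> v \<in> nbrs V E u"
  using sym by (auto simp: nbrs_def)

lemma in_nbrs: "u \<in> nbrs V E v \<longleftrightarrow> u \<in> V \<and> E v u"
  by (simp add: nbrs_def)

lemma nbrs_remove: "nbrs (V - X) E v = nbrs V E v - X"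
  by (auto simp: nbrs_def)

lemma finite_adj_pairs [simp]: "finite (adj_pairs V E)"
  by (rule finite_subset[of _ "V \<times> V"]) (use finite_V in \<open>auto simp: adj_pairs_def\<close>)

lemma sum_deg: "(\<Sum>v\<in>V. deg V E v) = card (adj_pairs V E)"
proof -
  have "adj_pairs V E = Sigma V (nbrs V E)" by (auto simp: adj_pairs_def nbrs_def)
  then show ?thesis using finite_V by simp
qed

lemma simple_graph_subset: "W \<subseteq> V \<Longrightarrow> simple_graph W E"
  using finite_V sym irrefl finite_subset by unfold_locales blast+

lemma adj_pairs_remove:
  assumes "v \<in> V"
  shows "card (adj_pairs V E) = card (adj_pairs (V - {v}) E) + 2 * deg V E v"
proof -
  let ?N = "nbrs V E v"
  have "adj_pairs V E = adj_pairs (V - {v}) E \<union> ({v} \<times> ?N \<union> ?N \<times> {v})"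
    using assms sym by (auto simp: adj_pairs_def nbrs_def)
  moreover have "card (adj_pairs (V - {v}) E \<union> ({v} \<times> ?N \<union> ?N \<times> {v}))
      = card (adj_pairs (V - {v}) E) + card ({v} \<times> ?N \<union> ?N \<times> {v})"
    using finite_subset[OF _ finite_adj_pairs, of "adj_pairs (V - {v}) E"]
    by (intro card_Un_disjoint) (auto simp: adj_pairs_def)
  moreover have "card ({v} \<times> ?N \<union> ?N \<times> {v}) = card ({v} \<times> ?N) + card (?N \<times> {v})"
    using nbrs_subset[of v] by (intro card_Un_disjoint) auto
  ultimately show ?thesis by (simp add: card_cartesian_product)
qed

text \<open>
  The three degrees count each edge of the triangle twice, which accounts for the 6 pairs on the left.
\<close>

lemma adj_pairs_remove_triangle:
  assumes "{a, b, c} \<subseteq> V" "E a b" "E a c" "E b c"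
  shows "card (adj_pairs V E) + 6
    = card (adj_pairs (V - {a, b, c}) E) + 2 * (deg V E a + deg V E b + deg V E c)"
proof -
  interpret A: simple_graph "V - {a}" E by (rule simple_graph_subset) blast
  interpret B: simple_graph "V - {a} - {b}" E by (rule A.simple_graph_subset) blast
  have ne: "a \<noteq> b" "a \<noteq> c" "b \<noteq> c" using assms irrefl by auto
  have N: "a \<in> nbrs V E b" "a \<in> nbrs V E c" "b \<in> nbrs V E c - {a}"
    using assms ne assms(2-4)[THEN sym] by (simp_all add: in_nbrs)
  have "deg V E b = deg (V - {a}) E b + 1"
    using card_Suc_Diff1[OF finite_nbrs N(1)] by (simp add: nbrs_remove)
  moreover have "deg V E c = deg (V - {a} - {b}) E c + 2"
    using card_Suc_Diff1[OF finite_nbrs N(2)] card_Suc_Diff1[OF _ N(3)]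
    by (simp add: A.nbrs_remove nbrs_remove)
  moreover have "V - {a, b, c} = V - {a} - {b} - {c}" by auto
  ultimately show ?thesis
    using adj_pairs_remove[of a] A.adj_pairs_remove[of b] B.adj_pairs_remove[of c] assms ne by simp
qed

lemma core_in_triple:
  assumes "core E T" "T \<subseteq> {a, b, c}"
  shows "E a b \<and> E b c \<and> E a c"
proof -
  have *: "\<And>t. t \<in> T \<Longrightarrow> \<exists>x\<in>T. \<exists>y\<in>T. x \<noteq> y \<and> E t x \<and> E t y" and "T \<noteq> {}"
    using assms(1) by (auto simp: core_def)
  have "a \<in> T \<and> b \<in> T \<and> c \<in> T"
    using * assms(2) \<open>T \<noteq> {}\<close> irrefl by blast
  with * assms(2) irrefl sym show ?thesis by (smt (verit) insert_iff empty_iff subset_iff)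
qed

text \<open>
  A core with three elements is a triangle. In a core with all four elements every vertex misses
  at most one other vertex, so that a 4-cycle remains. The last three disjuncts are the three
  4-cycles on four vertices.
\<close>

lemma core_in_quadruple:
  assumes "core E T" "T \<subseteq> {a, b, c, d}"
  shows "(E a b \<and> E b c \<and> E a c) \<or> (E a b \<and> E b d \<and> E a d) \<or> (E a c \<and> E c d \<and> E a d) \<or>
    (E b c \<and> E c d \<and> E b d) \<or> (E a b \<and> E b c \<and> E c d \<and> E d a) \<or>
    (E a b \<and> E b d \<and> E d c \<and> E c a) \<or> (E a c \<and> E c b \<and> E b d \<and> E d a)"
proof (cases "a \<in> T \<and> b \<in> T \<and> c \<in> T \<and> d \<in> T")
  case False
  then have "T \<subseteq> {b, c, d} \<or> T \<subseteq> {a, c, d} \<or> T \<subseteq> {a, b, d} \<or> T \<subseteq> {a, b, c}"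
    using assms(2) by blast
  then show ?thesis
    using core_in_triple[OF assms(1), of b c d] core_in_triple[OF assms(1), of a c d]
      core_in_triple[OF assms(1), of a b d] core_in_triple[OF assms(1), of a b c] by argo
next
  case True
  have *: "\<exists>x\<in>{a, b, c, d}. \<exists>y\<in>{a, b, c, d}. x \<noteq> y \<and> E t x \<and> E t y" if "t \<in> {a, b, c, d}" for t
    using assms that True unfolding core_def by blast
  have "(E a b \<and> E a c) \<or> (E a b \<and> E a d) \<or> (E a c \<and> E a d)" using *[of a] irrefl by auto
  moreover have "(E b a \<and> E b c) \<or> (E b a \<and> E b d) \<or> (E b c \<and> E b d)" using *[of b] irrefl by auto
  moreover have "(E c a \<and> E c b) \<or> (E c a \<and> E c d) \<or> (E c b \<and> E c d)" using *[of c] irrefl by auto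
  moreover have "(E d a \<and> E d b) \<or> (E d a \<and> E d c) \<or> (E d b \<and> E d c)" using *[of d] irrefl by auto
  ultimately show ?thesis using sym[of a b] sym[of b a] sym[of a c] sym[of c a] sym[of a d] sym[of d a]
    sym[of b c] sym[of c b] sym[of b d] sym[of d b] sym[of c d] sym[of d c] by argo
qed

lemma core_in_pair: "core E T \<Longrightarrow> T \<subseteq> {a, b} \<Longrightarrow> False"
  using core_in_triple[of T a b b] irrefl by auto

lemma core_card:
  assumes "core E T" "finite N" "T \<subseteq> N"
  shows "3 \<le> card N"
proof (rule ccontr)
  assume "\<not> 3 \<le> card N"
  then have "card N = 0 \<or> card N = 1 \<or> card N = 2" by linarith
  then obtain a b where "N \<subseteq> {a, b}"
    using assms(2) by (auto simp: card_1_singleton_iff card_2_iff)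
  then show False using core_in_pair assms by blast
qed

lemma separated_by_boundary:
  assumes "X \<subseteq> V" "X \<noteq> {}" "V \<noteq> X \<union> boundary V E X"
  shows "separated V E X (V - X - boundary V E X)"
  using assms by (auto simp: separated_def boundary_def)

lemma cut_cyclic_boundary:
  assumes "cut_cyclic V E" "X \<subseteq> V" "X \<noteq> {}" "V \<noteq> X \<union> boundary V E X"
  shows "\<exists>T \<subseteq> boundary V E X. core E T"
proof -
  have "V - X - (V - X - boundary V E X) = boundary V E X" by (auto simp: boundary_def)
  then show ?thesis
    using assms(1) separated_by_boundary[OF assms(2-4)] by (metis cut_cyclic_def)
qed

text \<open>
  A cut of the smaller graph whose two sides do not both meet the neighbourhood of \<open>X\<close> is also a cut of
  the original graph, with \<open>X\<close> added to one side. If both sides do meet it, in \<open>u\<close> and \<open>w\<close>, then all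
  common neighbours of \<open>u\<close> and \<open>w\<close> belong to the cut, and \<open>near\<close> supplies a core among them. The
  condition \<open>near\<close> is vacuous if the neighbourhood of \<open>X\<close> is a clique. The relation \<open>E'\<close> allows for
  edges that are inserted to make it one, or nearly so.
\<close>

lemma cut_cyclic_delete:
  assumes cc: "cut_cyclic V E" and X: "X \<subseteq> V"
    and le: "\<And>u v. E u v \<Longrightarrow> E' u v" and sym': "\<And>u v. E' u v \<Longrightarrow> E' v u"
    and near: "\<And>u w. u \<in> boundary V E X \<Longrightarrow> w \<in> boundary V E X \<Longrightarrow> u \<noteq> w \<Longrightarrow> \<not> E' u w \<Longrightarrow>
      \<exists>T \<subseteq> V - X. core E' T \<and> (\<forall>t\<in>T. E' u t \<and> E' w t)"
  shows "cut_cyclic (V - X) E'"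
  unfolding cut_cyclic_def
proof (intro allI impI)
  fix A B assume sep: "separated (V - X) E' A B"
  let ?N = "boundary V E X"
  have absorb: "\<exists>T\<subseteq>V - X - A - B. core E' T"
    if sep: "separated (V - X) E' A B" and B: "?N \<inter> B = {}" for A B
  proof -
    have no: "\<not> E u w" if "u \<in> X" "w \<in> B" for u w
      using B that sep by (auto simp: boundary_def separated_def)
    have "separated V E (A \<union> X) B"
      using sep X le no unfolding separated_def by blast
    then obtain T where "T \<subseteq> V - (A \<union> X) - B" "core E T" using cc unfolding cut_cyclic_def by meson
    moreover have "core E' T" using \<open>core E T\<close> le by (rule core_mono)
    ultimately show ?thesis by (intro exI[of _ T]) blast
  qed
  consider "?N \<inter> B = {}" | "?N \<inter> A = {}" | u w where "u \<in> ?N \<inter> A" "w \<in> ?N \<inter> B" by blast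
  then show "\<exists>T\<subseteq>V - X - A - B. core E' T"
  proof cases
    case 1
    then show ?thesis using absorb sep by blast
  next
    case 2
    moreover have "separated (V - X) E' B A" using sep sym' unfolding separated_def by blast
    ultimately have "\<exists>T\<subseteq>V - X - B - A. core E' T" using absorb by simp
    then show ?thesis by (simp only: Diff_eq Int_assoc Int_commute[of "- A"])
  next
    case 3
    then have "u \<noteq> w" "\<not> E' u w" using sep by (auto simp: separated_def)
    then obtain T where T: "T \<subseteq> V - X" "core E' T" "\<forall>t\<in>T. E' u t \<and> E' w t"
      using near[of u w] 3 by auto
    have "t \<notin> A \<and> t \<notin> B" if "t \<in> T" for t
    proof -
      have "E' u t" "E' t w" using T(3) that sym' by auto
      then show ?thesis using 3 sep unfolding separated_def by blast
    qed
    then show ?thesis using T by (intro exI[of _ T]) blast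
  qed
qed

text \<open>
  The new edge \<open>pr\<close> contracts \<open>v\<close> into \<open>p\<close>. A cut that separates two neighbours of \<open>v\<close> must separate
  \<open>q\<close> from \<open>s\<close> and therefore contain both \<open>p\<close> and \<open>r\<close>. Adding \<open>v\<close> gives a cut of the original
  graph, in which \<open>p\<close> and \<open>r\<close> are the only neighbours of \<open>v\<close>. A cycle in it that uses \<open>v\<close> runs
  through \<open>p\<close>, \<open>v\<close>, \<open>r\<close>, and becomes a cycle of the new graph if this path is replaced by the
  edge \<open>pr\<close>; this is where \<open>p\<close> and \<open>r\<close> have to be nonadjacent.
\<close>

lemma cut_cyclic_contract:
  assumes cc: "cut_cyclic V E" and v: "v \<in> V"
    and N: "nbrs V E v = {p, q, r, s}" and cyc: "E p q" "E q r" "E r s" "E s p"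
    and ne: "p \<noteq> r" and pr: "\<not> E p r"
    and E': "E' = (\<lambda>x y. E x y \<or> (x = p \<and> y = r) \<or> (x = r \<and> y = p))"
  shows "cut_cyclic (V - {v}) E'"
  unfolding cut_cyclic_def
proof (intro allI impI)
  have sym': "E' x y \<Longrightarrow> E' y x" for x y using sym by (auto simp: E')
  have V: "p \<in> V" "q \<in> V" "r \<in> V" "s \<in> V" using N by (auto simp: nbrs_def)
  have Nv: "E v u \<longleftrightarrow> u \<in> {p, q, r, s}" if "u \<in> V" for u using N that by (auto simp: nbrs_def)
  fix A B assume sep: "separated (V - {v}) E' A B"
  have absorb: "\<exists>T\<subseteq>V - {v} - A - B. core E' T"
    if sep: "separated (V - {v}) E' A B" and B: "nbrs V E v \<inter> B = {}" for A B
  proof -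
    have "separated V E (A \<union> {v}) B"
      using sep v B unfolding separated_def nbrs_def E' by blast
    then obtain T where "T \<subseteq> V - (A \<union> {v}) - B" "core E T" using cc unfolding cut_cyclic_def by meson
    moreover have "core E' T" using \<open>core E T\<close> by (rule core_mono) (simp add: E')
    ultimately show ?thesis by (intro exI[of _ T]) blast
  qed
  consider "nbrs V E v \<inter> B = {}" | "nbrs V E v \<inter> A = {}"
    | u w where "u \<in> nbrs V E v" "u \<in> A" "w \<in> nbrs V E v" "w \<in> B" by blast
  then show "\<exists>T\<subseteq>V - {v} - A - B. core E' T"
  proof cases
    case 1
    then show ?thesis using absorb sep by blast
  next
    case 2
    moreover have "separated (V - {v}) E' B A" using sep sym' unfolding separated_def by blast
    ultimately have "\<exists>T\<subseteq>V - {v} - B - A. core E' T" using absorb by simp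
    then show ?thesis by (simp only: Diff_eq Int_assoc Int_commute[of "- A"])
  next
    case 3
    have uw: "u \<noteq> w" "\<not> E' u w" using sep 3 by (auto simp: separated_def)
    have comm: "t \<notin> A \<and> t \<notin> B" if "E' u t" "E' w t" for t
      using that(1) sym'[OF that(2)] 3 sep unfolding separated_def by blast
    have "u \<in> {p, q, r, s}" "w \<in> {p, q, r, s}" using 3 N by auto
    moreover have "E' p q" "E' q p" "E' q r" "E' r q" "E' r s" "E' s r" "E' s p" "E' p s"
      "E' p r" "E' r p"
      using cyc cyc[THEN sym] by (auto simp: E')
    ultimately have "{u, w} = {q, s}" using uw by auto
    then have out: "p \<notin> A" "p \<notin> B" "r \<notin> A" "r \<notin> B" and qs: "q \<in> A \<union> B" "s \<in> A \<union> B"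
      using comm[of p] comm[of r] cyc sym 3 by (auto simp: E' doubleton_eq_iff)
    have "separated V E A B" using sep unfolding separated_def E' by blast
    then obtain T where T: "T \<subseteq> V - A - B" "core E T" using cc unfolding cut_cyclic_def by meson
    have two: "\<exists>x\<in>T. \<exists>y\<in>T. x \<noteq> y \<and> E t x \<and> E t y" if "t \<in> T" for t
      using T(2) that by (auto simp: core_def)
    show ?thesis
    proof (cases "v \<in> T")
      case False
      have "core E' T" using T(2) by (rule core_mono) (simp add: E')
      then show ?thesis using T(1) False by (intro exI[of _ T]) blast
    next
      case True
      have pos: "u = p \<or> u = r" if "u \<in> T" "E v u" for u
        using that T(1) Nv qs by auto
      then have prT: "p \<in> T" "r \<in> T" using two[OF True] by metis+
      have "\<exists>x\<in>T - {v}. \<exists>y\<in>T - {v}. x \<noteq> y \<and> E' t x \<and> E' t y" if t: "t \<in> T - {v}" for t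
      proof -
        obtain x y where xy: "x \<in> T" "y \<in> T" "x \<noteq> y" "E t x" "E t y" using two t by blast
        have pv: "p \<noteq> v" "r \<noteq> v" using N nbrs_subset by auto
        show ?thesis
        proof (cases "v = x \<or> v = y")
          case False
          then show ?thesis using xy by (auto simp: E')
        next
          case True
          then have tt: "t = p \<or> t = r" using pos xy sym t by blast
          obtain z where z: "z \<in> T" "z \<noteq> v" "E t z" using True xy by auto
          \<comment> \<open>In \<open>T - {v}\<close> the vertex \<open>t\<close> has lost the neighbour \<open>v\<close> and gained the other one of \<open>p\<close> and \<open>r\<close>.\<close>
          define t' where "t' = (if t = p then r else p)"
          have "t' \<noteq> z" "E' t t'" "t' \<in> T - {v}"
            using tt z(3) pr ne prT pv sym by (auto simp: t'_def E')
          then show ?thesis using z by (metis (no_types, lifting) DiffI E' singletonD)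
        qed
      qed
      moreover have "T - {v} \<noteq> {}" using prT ne by auto
      ultimately have "core E' (T - {v})" by (simp only: core_def) simp
      then show ?thesis using T(1) by (intro exI[of _ "T - {v}"]) auto
    qed
  qed
qed

end

section \<open>Three-connected graphs with cyclic neighbourhoods\<close>

text \<open>
  The connectivity and cyclicity hypotheses in terms of boundaries. The bound 6 on the number of
  vertices makes the sets \<open>X\<close> considered below nondominating.
\<close>

locale three_connected = simple_graph V E for V :: "'a set" and E +
  fixes k :: nat
  assumes large: "6 \<le> card V"
    and three_conn: "X \<subseteq> V \<Longrightarrow> X \<noteq> {} \<Longrightarrow> card (boundary V E X) \<le> 2 \<Longrightarrow> V = X \<union> boundary V E X"
    and cyclic: "X \<subseteq> V \<Longrightarrow> X \<noteq> {} \<Longrightarrow> card X \<le> k \<Longrightarrow> V \<noteq> X \<union> boundary V E X \<Longrightarrow>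
      \<exists>T \<subseteq> boundary V E X. core E T"
    and k_pos: "1 \<le> k"
begin

lemma no_small_boundary:
  assumes "{a, b, c} \<subseteq> V" "boundary V E {a, b, c} \<subseteq> {p, q}"
  shows False
proof -
  have "card (boundary V E {a, b, c}) \<le> card {p, q}" using assms(2) by (intro card_mono) auto
  also have "\<dots> \<le> 2" by (simp add: card_insert_if)
  finally have bd: "card (boundary V E {a, b, c}) \<le> 2" .
  have "card V \<le> card {a, b, c} + card (boundary V E {a, b, c})"
    using three_conn[OF assms(1) _ bd] card_Un_le by (metis insert_not_empty)
  moreover have "card {a, b, c} \<le> 3" by (auto simp: card_insert_if)
  ultimately show False using bd large by linarith
qed

lemma not_dominating:
  assumes "X \<subseteq> V" "boundary V E X \<subseteq> F" "card X + card F \<le> 5" "finite F"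
  shows "V \<noteq> X \<union> boundary V E X"
proof
  assume "V = X \<union> boundary V E X"
  then have "card V \<le> card (X \<union> F)"
    using assms finite_V finite_subset[OF assms(1)] by (intro card_mono) auto
  also have "\<dots> \<le> 5" using card_Un_le[of X F] assms(3) by linarith
  finally show False using large by simp
qed

lemma deg_ge_3:
  assumes "v \<in> V"
  shows "3 \<le> deg V E v"
proof (rule ccontr)
  assume "\<not> 3 \<le> deg V E v"
  then have d: "card (boundary V E {v}) \<le> 2" by (simp add: boundary_single)
  then have "V \<noteq> {v} \<union> boundary V E {v}"
    using assms by (intro not_dominating[of _ "boundary V E {v}"]) (auto simp: boundary_single)
  then show False using three_conn[of "{v}"] d assms by auto
qed

lemma deg_3_nbrs:
  assumes v: "v \<in> V" "deg V E v = 3" and u: "u \<in> nbrs V E v"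
  obtains b c where "nbrs V E v = {u, b, c}" "u \<noteq> b" "u \<noteq> c" "b \<noteq> c" "E u b" "E u c" "E b c"
    "b \<in> V" "c \<in> V" "u \<in> V" "E v u" "E v b" "E v c" "v \<noteq> u" "v \<noteq> b" "v \<noteq> c"
proof -
  have "card (nbrs V E v - {u}) = 2" using u v by simp
  then obtain b c where bc: "nbrs V E v - {u} = {b, c}" "b \<noteq> c" by (auto simp: card_2_iff)
  then have N: "nbrs V E v = {u, b, c}" using u by auto
  have "V \<noteq> {v} \<union> boundary V E {v}"
    using v by (intro not_dominating[of _ "nbrs V E v"]) (auto simp: boundary_single)
  then obtain T where "core E T" "T \<subseteq> {u, b, c}"
    using cyclic[of "{v}"] v k_pos by (auto simp: boundary_single N)
  then have "E u b \<and> E b c \<and> E u c" by (rule core_in_triple)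
  moreover have "u \<in> V \<and> E v u" "b \<in> V \<and> E v b" "c \<in> V \<and> E v c"
    using N by (auto simp: nbrs_def)
  moreover have "u \<noteq> b" "u \<noteq> c" using bc by auto
  ultimately show ?thesis by (intro that[of b c]) (use N bc irrefl in auto)
qed

text \<open>
  Otherwise \<open>v\<close> and \<open>u\<close> have the same two further neighbours, which separate them from the rest.
\<close>

lemma deg_3_nbr_deg:
  assumes v: "v \<in> V" "deg V E v = 3" and u: "u \<in> nbrs V E v"
  shows "4 \<le> deg V E u"
proof (rule ccontr)
  obtain b c where N: "nbrs V E v = {u, b, c}" "E u b" "E u c" "b \<noteq> c" "b \<in> V" "c \<in> V" "u \<in> V"
    "E v u" "v \<noteq> b" "v \<noteq> c" using deg_3_nbrs[OF assms] by metis
  assume "\<not> 4 \<le> deg V E u"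
  then have "deg V E u = 3" using deg_ge_3[OF \<open>u \<in> V\<close>] by linarith
  then have "nbrs V E u = {v, b, c}"
    using N v sym by (intro nbrs_eqI) (auto simp: nbrs_def)
  then have "boundary V E {v, u} \<subseteq> {b, c}" using v N by (auto simp: boundary_eq)
  then show False using no_small_boundary[of v u u b c] v N by simp
qed

definition cubic :: "'a set" where
  "cubic = {v \<in> V. deg V E v = 3}"

lemma finite_cubic: "finite cubic" and cubic_subset: "cubic \<subseteq> V"
  using finite_V by (auto simp: cubic_def)

lemma cubic_nbrs_subset: "v \<in> cubic \<Longrightarrow> nbrs V E v \<subseteq> V - cubic"
  using deg_3_nbr_deg by (fastforce simp: cubic_def nbrs_def)

text \<open>
  Adjacent vertices cannot both have degree 3, so the neighbours of the cubic vertex \<open>v\<close> are not cubic.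
\<close>

lemma cubic_triangle:
  assumes "v \<in> cubic" "u \<in> nbrs V E v"
  obtains b c where "nbrs V E v = {u, b, c}" "b \<noteq> c" "E b c" "b \<in> nbrs V E u" "c \<in> nbrs V E u"
    "b \<notin> cubic" "c \<notin> cubic" "u \<in> V - cubic" "v \<in> nbrs V E u" "v \<in> V" "b \<in> V" "c \<in> V"
proof -
  have v: "v \<in> V" "deg V E v = 3" using assms(1) by (auto simp: cubic_def)
  obtain b c where N: "nbrs V E v = {u, b, c}" "b \<noteq> c" "E u b" "E u c" "E b c" "b \<in> V" "c \<in> V" "E v u"
    using deg_3_nbrs[OF v assms(2)] by metis
  have "u \<in> V" using assms(2) by (simp add: nbrs_def)
  then show ?thesis
    by (intro that[of b c]) (use N cubic_nbrs_subset[OF assms(1)] sym v in \<open>auto simp: nbrs_def\<close>)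
qed

lemma card_cubic_nbrs:
  assumes "v \<in> cubic \<inter> nbrs V E u" "u \<in> V"
  shows "card (cubic \<inter> nbrs V E u) + 2 \<le> deg V E u"
proof -
  have "u \<in> nbrs V E v" using assms nbrs_commute[of u v] by (auto simp: cubic_def)
  then obtain b c where N: "b \<noteq> c" "b \<in> nbrs V E u" "c \<in> nbrs V E u" "b \<notin> cubic" "c \<notin> cubic"
    using cubic_triangle[of v u] assms by blast
  then have "card (cubic \<inter> nbrs V E u) \<le> card (nbrs V E u - {b, c})"
    by (intro card_mono) auto
  also have "\<dots> = deg V E u - 2" using N by (simp add: card_Diff_subset)
  finally show ?thesis using N card_mono[of "nbrs V E u" "{b, c}"] by simp
qed

text \<open>
  Distinct cubic neighbours \<open>v\<close> and \<open>w\<close> of \<open>u\<close> are not adjacent, so both are adjacent to the remaining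
  two neighbours \<open>b\<close> and \<open>c\<close> of \<open>u\<close>. Then \<open>b\<close> and \<open>c\<close> separate \<open>u\<close>, \<open>v\<close>, \<open>w\<close> from the rest.
\<close>

lemma quartic_cubic_nbr_unique:
  assumes u: "u \<in> V" "deg V E u = 4" and vw: "v \<in> cubic \<inter> nbrs V E u" "w \<in> cubic \<inter> nbrs V E u"
  shows "v = w"
proof (rule ccontr)
  assume ne: "v \<noteq> w"
  have V: "v \<in> V" "w \<in> V" using vw by (auto simp: cubic_def)
  have uv: "u \<in> nbrs V E v" "u \<in> nbrs V E w" using nbrs_commute u V vw by auto
  obtain b c where bc: "nbrs V E v = {u, b, c}" "b \<noteq> c" "b \<in> nbrs V E u" "c \<in> nbrs V E u"
    "b \<notin> cubic" "c \<notin> cubic" using cubic_triangle[of v u] uv(1) vw by blast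
  obtain b' c' where bc': "nbrs V E w = {u, b', c'}" "b' \<in> nbrs V E u" "c' \<in> nbrs V E u"
    "b' \<notin> cubic" "c' \<notin> cubic" using cubic_triangle[of w u] uv(2) vw by blast
  have Nu: "nbrs V E u = {v, w, b, c}"
    using vw bc ne u(2) by (intro nbrs_eqI) (auto simp: card_insert_if)
  then have "b' \<in> {b, c}" "c' \<in> {b, c}" using bc' vw by auto
  then have "boundary V E {u, v, w} \<subseteq> {b, c}"
    using V u by (simp only: boundary_eq insert_subset empty_subsetI simp_thms) (auto simp: Nu bc bc')
  then show False using no_small_boundary[of u v w b c] u V by simp
qed

lemma sum_payments:
  fixes c :: int
  assumes "u \<in> V"
  shows "(\<Sum>v\<in>cubic. if u \<in> nbrs V E v then c else 0) = c * int (card (cubic \<inter> nbrs V E u))"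
proof -
  have "(\<Sum>v\<in>cubic. if u \<in> nbrs V E v then c else 0)
      = (\<Sum>v\<in>cubic. if v \<in> cubic \<inter> nbrs V E u then c else 0)"
    using assms cubic_subset nbrs_commute by (intro sum.cong) auto
  then show ?thesis using sum_if_mem[of cubic "cubic \<inter> nbrs V E u" c] finite_cubic by simp
qed

text \<open>
  The charge of a vertex is 4 times the excess of its degree over \<open>15/4\<close>. Each cubic vertex lacks 3
  and gets 1 from each neighbour. A vertex of degree 4 can pay one cubic neighbour, and a vertex of
  larger degree can pay all its neighbours.
\<close>

lemma edge_bound_1_cyclic: "15 * card V \<le> 4 * card (adj_pairs V E)"
proof -
  have "0 \<le> (\<Sum>v\<in>V. 4 * int (deg V E v) - 15)"
  proof (rule discharging[OF finite_V cubic_subset, where w = "\<lambda>v u. if u \<in> nbrs V E v then 1 else 0"])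
    fix v assume v: "v \<in> cubic"
    have "(\<Sum>u\<in>V - cubic. if u \<in> nbrs V E v then 1 else 0 :: int) = 1 * int (deg V E v)"
      using finite_V cubic_nbrs_subset[OF v] by (intro sum_if_mem) auto
    then show "0 \<le> 4 * int (deg V E v) - 15 + (\<Sum>u\<in>V - cubic. if u \<in> nbrs V E v then 1 else 0)"
      using v by (simp add: cubic_def)
  next
    fix u assume u: "u \<in> V - cubic"
    let ?P = "cubic \<inter> nbrs V E u"
    have "int (card ?P) \<le> 4 * int (deg V E u) - 15"
    proof (cases "deg V E u = 4")
      case True
      have "card ?P \<le> 1"
        using quartic_cubic_nbr_unique[OF _ True] u finite_cubic card_le_Suc0_iff_eq[of ?P]
        by auto
      then show ?thesis using True by simp
    next
      case False
      then have "5 \<le> deg V E u" using u deg_ge_3[of u] by (auto simp: cubic_def)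
      moreover have "card ?P \<le> deg V E u" by (intro card_mono) auto
      ultimately show ?thesis by linarith
    qed
    then show "(\<Sum>v\<in>cubic. if u \<in> nbrs V E v then 1 else 0) \<le> 4 * int (deg V E u) - 15"
      using sum_payments[of u 1] u by simp
  qed
  also have "\<dots> = 4 * int (\<Sum>v\<in>V. deg V E v) - 15 * int (card V)"
    by (simp add: sum_subtractf sum_distrib_left)
  finally show ?thesis using sum_deg by simp
qed

text \<open>
  Suppose that \<open>x\<close> and \<open>y\<close> are distinct. Let \<open>c\<close> be the third neighbour of \<open>v\<close>, and \<open>z\<close> the fourth neighbour
  of \<open>x\<close>. The neighbourhood of \<open>{v, x}\<close> is \<open>{y, c, z}\<close> and must be a triangle. Hence \<open>z\<close> is the
  fourth neighbour of \<open>y\<close>, too, and \<open>c\<close> and \<open>z\<close> separate \<open>v\<close>, \<open>x\<close>, \<open>y\<close> from the rest.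
\<close>

lemma cubic_quartic_nbr_unique:
  assumes v: "v \<in> cubic" and x: "x \<in> nbrs V E v" "deg V E x = 4"
    and y: "y \<in> nbrs V E v" "deg V E y = 4" and k: "2 \<le> k"
  shows "x = y"
proof (rule ccontr)
  assume ne: "x \<noteq> y"
  obtain b c where bc: "nbrs V E v = {x, b, c}" "b \<noteq> c" "E b c" "b \<in> nbrs V E x" "c \<in> nbrs V E x"
    "v \<in> nbrs V E x" "v \<in> V" "b \<in> V" "c \<in> V" "x \<in> V - cubic" using cubic_triangle[OF v x(1)] by metis
  obtain c where c: "nbrs V E v = {x, y, c}" "y \<noteq> c" "E y c" "y \<in> nbrs V E x" "c \<in> nbrs V E x"
    "v \<in> nbrs V E x" "v \<in> V" "y \<in> V" "c \<in> V" "x \<in> V"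
  proof (cases "y = b")
    case True
    then show ?thesis using that[of c] bc by auto
  next
    case False
    then have "y = c" using y(1) ne bc(1) by auto
    then show ?thesis using that[of b] bc sym by (auto simp: insert_commute)
  qed
  have ne': "v \<noteq> x" "v \<noteq> y" "v \<noteq> c" "x \<noteq> y" "x \<noteq> c"
    using c nbrs_subset[of v] nbrs_subset[of x] by auto
  have "card (nbrs V E x - {v, y, c}) = 1" using c ne' x by (simp add: card_Diff_subset)
  then obtain z where z: "nbrs V E x - {v, y, c} = {z}" by (auto simp: card_1_singleton_iff)
  then have Nx: "nbrs V E x = {v, y, c, z}" using c by blast
  have bd: "boundary V E {v, x} \<subseteq> {y, c, z}"
    using c by (simp add: boundary_eq) (auto simp: Nx)
  have "V \<noteq> {v, x} \<union> boundary V E {v, x}"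
    using c ne' by (intro not_dominating[OF _ bd]) (auto simp: card_insert_if)
  then obtain T where "core E T" "T \<subseteq> {y, c, z}"
    using cyclic[of "{v, x}"] bd c ne' k by (auto simp: card_insert_if)
  then have "E y z" using core_in_triple by blast
  have zx: "z \<in> nbrs V E x" and zne: "z \<noteq> v" "z \<noteq> c" using z by auto
  then have "z \<noteq> x" "z \<in> V" using nbrs_subset[of x] by auto
  have "v \<in> nbrs V E y" "x \<in> nbrs V E y" using nbrs_commute c y(1) by auto
  moreover have "c \<in> nbrs V E y" "z \<in> nbrs V E y"
    using c \<open>E y z\<close> \<open>z \<in> V\<close> by (auto simp: nbrs_def)
  moreover have "card {v, x, c, z} = 4" using ne' zne \<open>z \<noteq> x\<close> by auto
  ultimately have Ny: "nbrs V E y = {v, x, c, z}" using y(2) by (intro nbrs_eqI) auto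
  have "boundary V E {v, x, y} \<subseteq> {c, z}"
    using c by (simp add: boundary_eq) (auto simp: Nx Ny)
  then show False using no_small_boundary[of v x y c z] c by simp
qed

text \<open>
  What \<open>u\<close> pays to the cubic vertex \<open>v\<close>: the deficit 6 is shared equally by the neighbours of \<open>v\<close> of
  degree at least 5. By \<open>cubic_quartic_nbr_unique\<close> there are two or three of them.
\<close>

definition triangle_payment :: "'a \<Rightarrow> 'a \<Rightarrow> int" where
  "triangle_payment v u = (if u \<notin> nbrs V E v then 0
     else if \<exists>x\<in>nbrs V E v. deg V E x = 4 then (if deg V E u = 4 then 0 else 3) else 2)"

lemma triangle_payment_le_3: "triangle_payment v u \<le> (if u \<in> nbrs V E v then 3 else 0)"
  by (simp add: triangle_payment_def)

text \<open>
  The charge of a vertex is 6 times the excess of its degree over 4. A vertex of degree \<open>d\<close> has at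
  most \<open>d - 2\<close> cubic neighbours, so it can afford to pay 3 to each of them if \<open>d \<ge> 6\<close>, and also if
  \<open>d = 5\<close> and there are at most two of them.
\<close>

lemma edge_bound_2_cyclic:
  assumes k: "2 \<le> k"
  shows "4 * card V \<le> card (adj_pairs V E)"
proof -
  have "0 \<le> (\<Sum>v\<in>V. 6 * int (deg V E v) - 24)"
  proof (rule discharging[OF finite_V cubic_subset, where w = triangle_payment])
    fix v assume v: "v \<in> cubic"
    note sub = cubic_nbrs_subset[OF v]
    have d: "deg V E v = 3" using v by (simp add: cubic_def)
    have "6 \<le> (\<Sum>u\<in>V - cubic. triangle_payment v u)"
    proof (cases "\<exists>x\<in>nbrs V E v. deg V E x = 4")
      case True
      then obtain x where x: "x \<in> nbrs V E v" "deg V E x = 4" by blast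
      have "deg V E u = 4 \<longleftrightarrow> u = x" if "u \<in> nbrs V E v" for u
        using cubic_quartic_nbr_unique[OF v x that _ k] x(2) by blast
      then have "triangle_payment v u = (if u \<in> nbrs V E v - {x} then 3 else 0)" for u
        using True by (simp add: triangle_payment_def)
      then have "(\<Sum>u\<in>V - cubic. triangle_payment v u)
          = (\<Sum>u\<in>V - cubic. if u \<in> nbrs V E v - {x} then 3 else 0)" by simp
      also have "\<dots> = 3 * int (card (nbrs V E v - {x}))"
        using finite_V sub by (intro sum_if_mem) auto
      finally show ?thesis using x d by simp
    next
      case False
      then have "triangle_payment v u = (if u \<in> nbrs V E v then 2 else 0)" for u
        by (simp add: triangle_payment_def)
      then have "(\<Sum>u\<in>V - cubic. triangle_payment v u) = (\<Sum>u\<in>V - cubic. if u \<in> nbrs V E v then 2 else 0)"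
        by simp
      also have "\<dots> = 2 * int (deg V E v)"
        using finite_V sub by (intro sum_if_mem) auto
      finally show ?thesis using d by simp
    qed
    then show "0 \<le> 6 * int (deg V E v) - 24 + (\<Sum>u\<in>V - cubic. triangle_payment v u)" using d by simp
  next
    fix u assume u: "u \<in> V - cubic"
    let ?P = "cubic \<inter> nbrs V E u"
    have "(\<Sum>v\<in>cubic. triangle_payment v u) \<le> (\<Sum>v\<in>cubic. if u \<in> nbrs V E v then 3 else 0)"
      using triangle_payment_le_3 by (intro sum_mono)
    then have le3: "(\<Sum>v\<in>cubic. triangle_payment v u) \<le> 3 * int (card ?P)"
      using sum_payments[of u 3] u by simp
    have cubicV: "v \<in> V" if "v \<in> cubic" for v using that by (simp add: cubic_def)
    show "(\<Sum>v\<in>cubic. triangle_payment v u) \<le> 6 * int (deg V E u) - 24"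
    proof (cases "?P = {}")
      case True
      have "4 \<le> deg V E u" using u deg_ge_3[of u] by (auto simp: cubic_def)
      then show ?thesis using le3 True by simp
    next
      case False
      then obtain v where v: "v \<in> ?P" by blast
      have P: "card ?P + 2 \<le> deg V E u" using card_cubic_nbrs[OF v] u by simp
      consider "deg V E u = 4" | "deg V E u = 5" "card ?P \<le> 2" | "deg V E u = 5" "card ?P = 3"
        | "6 \<le> deg V E u"
        using u deg_ge_3[of u] P by (auto simp: cubic_def) linarith
      then show ?thesis
      proof cases
        case 1
        then have "(\<Sum>v\<in>cubic. triangle_payment v u) = 0" by (intro sum.neutral) (auto simp: triangle_payment_def)
        then show ?thesis using 1 by simp
      next
        case 2
        then show ?thesis using le3 by simp
      next
        case 3
        have uv: "u \<in> nbrs V E v" using v u nbrs_commute cubicV by auto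
        obtain p q where pq: "nbrs V E v = {u, p, q}" "p \<noteq> q" "E p q" "p \<in> nbrs V E u" "q \<in> nbrs V E u"
          "p \<notin> cubic" "q \<notin> cubic" "p \<in> V" "q \<in> V"
          using cubic_triangle[OF _ uv] v by blast
        \<comment> \<open>The three cubic neighbours of \<open>u\<close> are all joined to the other two neighbours \<open>p\<close> and \<open>q\<close>, which
        therefore have degree at least 5. So no payment of 3 is requested, and 2 to each is affordable.\<close>
        have "?P = nbrs V E u - {p, q}"
          using pq 3 by (intro card_subset_eq) (auto simp: card_Diff_subset)
        then have Nu: "nbrs V E u - ?P = {p, q}" using pq by auto
        have Nw: "nbrs V E w = {u, p, q}" if w: "w \<in> ?P" for w
        proof -
          have uw: "u \<in> nbrs V E w" using w u nbrs_commute cubicV by auto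
          obtain p' q' where pq': "nbrs V E w = {u, p', q'}" "p' \<noteq> q'"
            "p' \<in> nbrs V E u" "q' \<in> nbrs V E u" "p' \<notin> cubic" "q' \<notin> cubic"
            using cubic_triangle[OF _ uw] w by blast
          then have "p' \<in> nbrs V E u - ?P" "q' \<in> nbrs V E u - ?P" by simp_all
          then have "{p', q'} = {p, q}" using pq'(2) unfolding Nu by auto
          then show ?thesis using pq'(1) by simp
        qed
        have five: "5 \<le> deg V E r" if r: "r \<in> {p, q}" for r
        proof -
          define r' where "r' = (if r = p then q else p)"
          have "insert u (insert r' ?P) \<subseteq> nbrs V E r"
          proof -
            have "?P \<subseteq> nbrs V E r" using Nw r nbrs_commute[of r] pq cubicV by blast
            moreover have "u \<in> nbrs V E r" using r pq nbrs_commute[of u r] u by auto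
            moreover have "r' \<in> nbrs V E r" using r pq sym by (auto simp: nbrs_def r'_def)
            ultimately show ?thesis by blast
          qed
          moreover have "card (insert u (insert r' ?P)) = 5"
          proof -
            have "r' \<notin> ?P" "u \<notin> ?P" "u \<noteq> r'" using pq u nbrs_subset[of u] by (auto simp: r'_def)
            then show ?thesis using 3 finite_cubic by simp
          qed
          ultimately show ?thesis using card_mono[OF finite_nbrs] by metis
        qed
        have "triangle_payment w u \<le> (if u \<in> nbrs V E w then 2 else 0)" if w: "w \<in> cubic" for w
        proof (cases "u \<in> nbrs V E w")
          case True
          then have "nbrs V E w = {u, p, q}" using Nw w u nbrs_commute cubicV by auto
          then show ?thesis using five[of p] five[of q] 3 by (auto simp: triangle_payment_def)
        qed (simp add: triangle_payment_def)
        then have "(\<Sum>v\<in>cubic. triangle_payment v u) \<le> (\<Sum>v\<in>cubic. if u \<in> nbrs V E v then 2 else 0)"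
          by (intro sum_mono)
        then show ?thesis using sum_payments[of u 2] u 3 by simp
      next
        case 4
        then show ?thesis using le3 P by linarith
      qed
    qed
  qed
  also have "\<dots> = 6 * int (\<Sum>v\<in>V. deg V E v) - 24 * int (card V)"
    by (simp add: sum_subtractf sum_distrib_left)
  finally show ?thesis using sum_deg by simp
qed

end

section \<open>Graphs in which every vertex cut contains a cycle\<close>

locale minimal_counterexample = simple_graph V E for V :: "'a set" and E +
  assumes cut_cyclic: "cut_cyclic V E"
    and smaller: "simple_graph (W :: 'a set) F \<Longrightarrow> cut_cyclic W F \<Longrightarrow> card W < card V \<Longrightarrow>
      9 * card W \<le> 2 * card (adj_pairs W F) + 15"
    and counterexample: "2 * card (adj_pairs V E) + 15 < 9 * card V"
begin

text \<open>
  A minimal counterexample cannot be turned into a smaller graph without forest cuts by deleting \<open>k\<close>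
  vertices and at least \<open>9 k / 4\<close> edges. The inequality is scaled by 4, and the pairs count every
  edge twice.
\<close>

lemma no_reduction:
  assumes "simple_graph (W :: 'a set) F" "cut_cyclic W F" "card V = card W + k" "0 < k"
    and "2 * card (adj_pairs W F) + 9 * k \<le> 2 * card (adj_pairs V E)"
  shows False
  using smaller[OF assms(1,2)] counterexample assms(3-5) by simp

lemma core_in_boundary:
  assumes "X \<subseteq> V" "X \<noteq> {}" "boundary V E X \<subseteq> F" "finite F" "card X + card F < card V"
  shows "\<exists>T \<subseteq> F. core E T"
proof -
  have "V \<noteq> X \<union> boundary V E X"
  proof
    assume "V = X \<union> boundary V E X"
    then have "card V \<le> card (X \<union> F)"
      using assms finite_subset[OF assms(1) finite_V] by (intro card_mono) auto
    then show False using card_Un_le[of X F] assms(5) by linarith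
  qed
  from cut_cyclic_boundary[OF cut_cyclic assms(1,2) this] show ?thesis using assms(3) by blast
qed

lemma core_in_nbrs:
  assumes "v \<in> V" "deg V E v + 1 < card V"
  obtains T where "T \<subseteq> nbrs V E v" "core E T"
proof -
  have "\<exists>T \<subseteq> nbrs V E v. core E T"
    by (rule core_in_boundary[of "{v}"]) (use assms in \<open>simp_all add: boundary_single\<close>)
  then show ?thesis using that by blast
qed

text \<open>
  Two nonadjacent vertices would be separated by the at most two other vertices, which contain no
  core. So the graph would be complete, and complete graphs with at most four vertices satisfy the
  bound.
\<close>

lemma card_V_ge_5: "5 \<le> card V"
proof (rule ccontr)
  assume "\<not> 5 \<le> card V"
  have "E u v" if uv: "u \<in> V" "v \<in> V" "u \<noteq> v" for u v
  proof (rule ccontr)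
    assume "\<not> E u v"
    then have "separated V E {u} {v}" using uv by (auto simp: separated_def)
    then obtain T where "T \<subseteq> V - {u} - {v}" "core E T"
      using cut_cyclic unfolding cut_cyclic_def by meson
    then have "3 \<le> card (V - {u} - {v})" using core_card finite_V by blast
    then show False using uv \<open>\<not> 5 \<le> card V\<close> finite_V by simp
  qed
  then have "nbrs V E v = V - {v}" if "v \<in> V" for v using that irrefl by (auto simp: nbrs_def)
  then have "(\<Sum>v\<in>V. deg V E v) = (\<Sum>v\<in>V. card V - 1)" using finite_V by (intro sum.cong) auto
  then have pairs: "card (adj_pairs V E) = card V * (card V - 1)" using sum_deg by simp
  have "card V = 0 \<or> card V = 1 \<or> card V = 2 \<or> card V = 3 \<or> card V = 4"
    using \<open>\<not> 5 \<le> card V\<close> by linarith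
  then show False using counterexample pairs by auto
qed

lemma no_clique_neighbourhood:
  assumes v: "v \<in> V" and clique: "\<And>x y. x \<in> nbrs V E v \<Longrightarrow> y \<in> nbrs V E v \<Longrightarrow> x \<noteq> y \<Longrightarrow> E x y"
    and d: "3 \<le> deg V E v"
  shows False
proof (rule no_reduction[where k = 1])
  show "simple_graph (V - {v}) E" by (rule simple_graph_subset) blast
  show "cut_cyclic (V - {v}) E"
    by (rule cut_cyclic_delete[OF cut_cyclic]) (use v clique sym boundary_single in auto)
  show "card V = card (V - {v}) + 1" using v finite_V card_Suc_Diff1[of V v] by simp
  show "2 * card (adj_pairs (V - {v}) E) + 9 * 1 \<le> 2 * card (adj_pairs V E)"
    using adj_pairs_remove[OF v] d by simp
qed simp

text \<open>
  The neighbourhood of a vertex of degree at most 3 contains a core, so it is a triangle, and the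
  vertex can be deleted.
\<close>

lemma deg_ge_4:
  assumes v: "v \<in> V"
  shows "4 \<le> deg V E v"
proof (rule ccontr)
  assume d: "\<not> 4 \<le> deg V E v"
  obtain T where T: "T \<subseteq> nbrs V E v" "core E T"
    using core_in_nbrs[OF v] d card_V_ge_5 by auto
  have "3 \<le> deg V E v" using core_card[OF T(2) finite_nbrs T(1)] .
  then have "deg V E v = 3" using d by linarith
  then obtain a b c where N: "nbrs V E v = {a, b, c}" by (auto simp: card_3_iff)
  then have "E a b \<and> E b c \<and> E a c" using core_in_triple T by metis
  then show False
    using no_clique_neighbourhood[OF v _ \<open>3 \<le> deg V E v\<close>] sym by (auto simp: N)
qed

text \<open>
  With minimum degree 4 there are at least \<open>2 n\<close> edges, and \<open>2 n \<ge> 9 n / 4 - 15 / 4\<close> for \<open>n \<le> 15\<close>.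
\<close>

lemma card_V_ge_16: "16 \<le> card V"
proof -
  have "(\<Sum>v\<in>V. 4) \<le> (\<Sum>v\<in>V. deg V E v)" using deg_ge_4 by (rule sum_mono)
  then show ?thesis using counterexample sum_deg by simp
qed

text \<open>
  Contracting \<open>v\<close> into \<open>p\<close> removes one vertex and at least three edges: four at \<open>v\<close>, with one new
  edge.
\<close>

lemma opposite_nbrs_adjacent:
  assumes v: "v \<in> V" "deg V E v = 4" and N: "nbrs V E v = {p, q, r, s}"
    and cyc: "E p q" "E q r" "E r s" "E s p" and ne: "p \<noteq> r"
  shows "E p r"
proof (rule ccontr)
  assume pr: "\<not> E p r"
  define F where "F = (\<lambda>x y. E x y \<or> (x = p \<and> y = r) \<or> (x = r \<and> y = p))"
  let ?W = "V - {v}"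
  have fin: "finite (adj_pairs ?W E)"
    using simple_graph.finite_adj_pairs[OF simple_graph_subset, of ?W] by blast
  show False
  proof (rule no_reduction[where k = 1])
    show "simple_graph ?W F" using finite_V sym irrefl ne by unfold_locales (auto simp: F_def)
    show "cut_cyclic ?W F" by (rule cut_cyclic_contract[OF cut_cyclic v(1) N cyc ne pr F_def])
    show "card V = card ?W + 1" using v finite_V card_Suc_Diff1[of V v] by simp
    have "card (adj_pairs ?W F) \<le> card (adj_pairs ?W E \<union> {(p, r), (r, p)})"
      using fin by (intro card_mono) (auto simp: adj_pairs_def F_def)
    also have "\<dots> \<le> card (adj_pairs ?W E) + card {(p, r), (r, p)}" by (rule card_Un_le)
    also have "card {(p, r), (r, p)} = 2" using ne by simp
    finally show "2 * card (adj_pairs ?W F) + 9 * 1 \<le> 2 * card (adj_pairs V E)"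
      using adj_pairs_remove[OF v(1)] v(2) by simp
  qed simp
qed

lemma no_4_cycle_in_neighbourhood:
  assumes v: "v \<in> V" "deg V E v = 4" and N: "nbrs V E v = {p, q, r, s}"
    and cyc: "E p q" "E q r" "E r s" "E s p"
  shows False
proof -
  have "card {p, q, r, s} = 4" using v N by simp
  then have ne: "p \<noteq> r" "q \<noteq> s" by (auto simp: card_insert_if split: if_splits)
  have "E p r" by (rule opposite_nbrs_adjacent[OF v N cyc ne(1)])
  moreover have "nbrs V E v = {q, r, s, p}" using N by auto
  then have "E q s" using opposite_nbrs_adjacent[OF v _ cyc(2,3,4,1) ne(2)] by blast
  ultimately show False
    using no_clique_neighbourhood[OF v(1)] v(2) cyc sym by (auto simp: N)
qed

definition low :: "'a set" where
  "low = {v \<in> V. deg V E v = 4}"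

definition K4 :: "'a \<Rightarrow> 'a \<Rightarrow> 'a \<Rightarrow> 'a \<Rightarrow> bool" where
  "K4 a b c d \<longleftrightarrow> {a, b, c, d} \<subseteq> V \<and> E a b \<and> E a c \<and> E a d \<and> E b c \<and> E b d \<and> E c d"

lemma K4_swap: "K4 a b c d \<Longrightarrow> K4 b a c d" "K4 a b c d \<Longrightarrow> K4 a c b d" "K4 a b c d \<Longrightarrow> K4 a b d c"
  using sym by (auto simp: K4_def)

lemma K4_distinct: "K4 a b c d \<Longrightarrow> distinct [a, b, c, d]"
  using irrefl by (auto simp: K4_def)

text \<open>
  If the fourth neighbour \<open>d\<close> had two neighbours in the triangle \<open>{a, b, c}\<close>, it would form a 4-cycle
  with the triangle. In particular \<open>{v, a, b, c}\<close> is the only \<open>K4\<close> that contains \<open>v\<close>.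
\<close>

lemma low_in_K4:
  assumes "v \<in> low" "K4 v a b c"
  obtains d where "nbrs V E v = {a, b, c, d}" "d \<notin> {v, a, b, c}" "d \<in> V" "E v d"
    "\<not> (E d a \<and> E d b)" "\<not> (E d a \<and> E d c)" "\<not> (E d b \<and> E d c)"
proof -
  have v: "v \<in> V" "deg V E v = 4" using assms(1) by (auto simp: low_def)
  have abc: "{a, b, c} \<subseteq> nbrs V E v" "distinct [v, a, b, c]"
    using assms(2) K4_distinct[OF assms(2)] by (auto simp: K4_def in_nbrs)
  have "card (nbrs V E v - {a, b, c}) = 1" using v abc by (subst card_Diff_subset) auto
  then obtain d where d: "nbrs V E v - {a, b, c} = {d}" by (auto simp: card_1_singleton_iff)
  then have N: "nbrs V E v = {a, b, c, d}" using abc by auto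
  have dN: "d \<in> nbrs V E v" "d \<notin> {a, b, c}" using d by auto
  have E: "E a b" "E b c" "E a c" "E b a" "E c b" "E c a" using assms(2) sym by (auto simp: K4_def)
  have "\<not> (E d a \<and> E d b)"
  proof
    assume "E d a \<and> E d b"
    then have "E d a" "E b d" using sym by auto
    moreover have "nbrs V E v = {d, a, c, b}" using N by auto
    ultimately show False using no_4_cycle_in_neighbourhood[OF v] E by blast
  qed
  moreover have "\<not> (E d a \<and> E d c)"
  proof
    assume "E d a \<and> E d c"
    then have "E d a" "E c d" using sym by auto
    moreover have "nbrs V E v = {d, a, b, c}" using N by auto
    ultimately show False using no_4_cycle_in_neighbourhood[OF v] E by blast
  qed
  moreover have "\<not> (E d b \<and> E d c)"
  proof
    assume "E d b \<and> E d c"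
    then have "E d b" "E c d" using sym by auto
    moreover have "nbrs V E v = {d, b, a, c}" using N by auto
    ultimately show False using no_4_cycle_in_neighbourhood[OF v] E by blast
  qed
  ultimately show ?thesis
    using N dN nbrs_subset[of v] by (intro that[of d]) (auto simp: in_nbrs)
qed

lemma low_K4_ex:
  assumes v: "v \<in> low"
  obtains a b c where "K4 v a b c"
proof -
  have vV: "v \<in> V" "deg V E v = 4" using assms by (auto simp: low_def)
  then have "card (nbrs V E v) = Suc 3" by simp
  then obtain a M where "nbrs V E v = insert a M" "card M = 3" by (metis card_Suc_eq)
  then obtain b c d where N: "nbrs V E v = {a, b, c, d}" by (auto simp: card_3_iff)
  obtain T where "T \<subseteq> nbrs V E v" "core E T"
    using core_in_nbrs[OF vV(1)] vV(2) card_V_ge_16 by auto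
  then have "T \<subseteq> {a, b, c, d}" "core E T" by (simp_all add: N)
  note cases = core_in_quadruple[OF this(2,1)]
  have N': "nbrs V E v = {a, b, d, c}" "nbrs V E v = {a, c, b, d}" using N by auto
  have "(E a b \<and> E b c \<and> E a c) \<or> (E a b \<and> E b d \<and> E a d) \<or> (E a c \<and> E c d \<and> E a d) \<or>
    (E b c \<and> E c d \<and> E b d)"
    using cases no_4_cycle_in_neighbourhood[OF vV N] no_4_cycle_in_neighbourhood[OF vV N'(1)]
      no_4_cycle_in_neighbourhood[OF vV N'(2)] by argo
  moreover have "a \<in> V" "b \<in> V" "c \<in> V" "d \<in> V" "E v a" "E v b" "E v c" "E v d"
    using N by (auto simp: nbrs_def)
  ultimately show ?thesis
    using that[of a b c] that[of a b d] that[of a c d] that[of b c d] vV by (auto simp: K4_def)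
qed

text \<open>
  For a vertex \<open>v\<close> of degree 4 these are the other three vertices of the unique \<open>K4\<close> that contains \<open>v\<close>.
\<close>

definition mates :: "'a \<Rightarrow> 'a set" where
  "mates v = {u \<in> nbrs V E v. \<exists>x y. K4 v u x y}"

lemma mates_eq:
  assumes "v \<in> low" "K4 v a b c"
  shows "mates v = {a, b, c}"
proof -
  obtain d where d: "nbrs V E v = {a, b, c, d}" "d \<notin> {v, a, b, c}"
    "\<not> (E d a \<and> E d b)" "\<not> (E d a \<and> E d c)" "\<not> (E d b \<and> E d c)"
    using low_in_K4[OF assms] by metis
  have "\<not> K4 v d x y" for x y
  proof
    assume K: "K4 v d x y"
    then have "x \<in> {a, b, c}" "y \<in> {a, b, c}" "x \<noteq> y"
      using d(1) K4_distinct[OF K] by (auto simp: K4_def nbrs_def)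
    moreover have "E d x" "E d y" using K by (auto simp: K4_def)
    ultimately show False using d(3-5) by auto
  qed
  moreover have "K4 v b a c" "K4 v c a b" using assms(2) sym by (auto simp: K4_def)
  ultimately show ?thesis using assms(2) d by (auto simp: mates_def)
qed

lemma mates_K4:
  assumes v: "v \<in> low" and u: "u \<in> mates v"
  obtains x y where "K4 v u x y" "mates v = {u, x, y}"
  using u mates_eq[OF v] by (auto simp: mates_def)

text \<open>
  The neighbourhood of \<open>{v, a}\<close> is \<open>{b, c, d, x}\<close>, where \<open>d\<close> and \<open>x\<close> are the neighbours of \<open>v\<close> and \<open>a\<close>
  outside the \<open>K4\<close>. Each of \<open>d\<close> and \<open>x\<close> has at most one neighbour among \<open>b\<close> and \<open>c\<close>, so a core is only
  possible if \<open>d\<close> and \<open>x\<close> are distinct and adjacent and each of them has exactly one such neighbour.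
\<close>

lemma two_low_in_K4:
  assumes v: "v \<in> low" and a: "a \<in> low" and K: "K4 v a b c"
  obtains d x where "nbrs V E v = {a, b, c, d}" "nbrs V E a = {v, b, c, x}" "d \<noteq> x" "E d x"
    "d \<notin> {v, a, b, c}" "x \<notin> {v, a, b, c}" "d \<in> V" "x \<in> V"
    "E d b \<or> E d c" "E x b \<or> E x c" "\<not> (E d b \<and> E d c)" "\<not> (E x b \<and> E x c)"
proof -
  have K': "K4 a v b c" using K by (rule K4_swap)
  obtain d where d: "nbrs V E v = {a, b, c, d}" "d \<notin> {v, a, b, c}" "d \<in> V" "E v d"
    "\<not> (E d a \<and> E d b)" "\<not> (E d a \<and> E d c)" "\<not> (E d b \<and> E d c)"
    using low_in_K4[OF v K] by metis
  obtain x where x: "nbrs V E a = {v, b, c, x}" "x \<notin> {a, v, b, c}" "x \<in> V" "E a x"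
    "\<not> (E x v \<and> E x b)" "\<not> (E x v \<and> E x c)" "\<not> (E x b \<and> E x c)"
    using low_in_K4[OF a K'] by metis
  have V: "v \<in> V" "a \<in> V" "E b c" "E c b" using K sym by (auto simp: K4_def)
  have "boundary V E {v, a} \<subseteq> {b, c, d, x}"
    using V d(1) x(1) by (auto simp: boundary_eq)
  moreover have "card {v, a} + card {b, c, d, x} \<le> 2 + 4"
    by (intro add_mono) (auto simp: card_insert_if)
  ultimately have "\<exists>T \<subseteq> {b, c, d, x}. core E T"
    using V card_V_ge_16 by (intro core_in_boundary[of "{v, a}"]) simp_all
  then obtain T where T: "T \<subseteq> {b, c, d, x}" "core E T" by blast
  have ne: "d \<noteq> x"
  proof
    assume "d = x"
    then have "E b d \<and> E c d" using core_in_triple[OF T(2), of b c d] T(1) by auto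
    then show False using d(7) sym by blast
  qed
  have s: "E d b \<longleftrightarrow> E b d" "E d c \<longleftrightarrow> E c d" "E x b \<longleftrightarrow> E b x" "E x c \<longleftrightarrow> E c x" "E d x \<longleftrightarrow> E x d"
    using sym by blast+
  have "E d x \<and> (E d b \<or> E d c) \<and> (E x b \<or> E x c)"
    using core_in_quadruple[OF T(2,1)] d(7) x(7) unfolding s by argo
  then show ?thesis using d x ne by (intro that[of d x]) auto
qed

text \<open>
  Let \<open>d\<close>, \<open>x\<close>, \<open>y\<close> be the outer neighbours of \<open>v\<close>, \<open>a\<close>, \<open>b\<close>. By \<open>two_low_in_K4\<close> for each pair they are
  distinct and pairwise adjacent. As none of them has a second neighbour among \<open>v\<close>, \<open>a\<close>, \<open>b\<close>, all
  three are adjacent to \<open>c\<close>. So the neighbourhood of \<open>{v, a, b}\<close> is a clique, and these three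
  vertices can be deleted together with 9 edges.
\<close>

lemma not_three_low_in_K4:
  assumes low: "v \<in> low" "a \<in> low" "b \<in> low" and K: "K4 v a b c"
  shows False
proof -
  obtain d x where dx: "nbrs V E v = {a, b, c, d}" "nbrs V E a = {v, b, c, x}" "d \<noteq> x" "E d x"
    "d \<notin> {v, a, b, c}" "x \<notin> {v, a, b, c}" "d \<in> V" "x \<in> V"
    "E d b \<or> E d c" "E x b \<or> E x c" "\<not> (E d b \<and> E d c)" "\<not> (E x b \<and> E x c)"
    using two_low_in_K4[OF low(1,2) K] by metis
  have Kb: "K4 v b a c" using K by (rule K4_swap)
  obtain d' y where y: "nbrs V E v = {b, a, c, d'}" "nbrs V E b = {v, a, c, y}" "d' \<noteq> y" "E d' y"
    "d' \<notin> {v, b, a, c}" "y \<notin> {v, b, a, c}" "y \<in> V"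
    "E d' a \<or> E d' c" "E y a \<or> E y c" "\<not> (E d' a \<and> E d' c)" "\<not> (E y a \<and> E y c)"
    using two_low_in_K4[OF low(1,3) Kb] by metis
  have "d' = d" using dx(1,5) y(1,5) by auto
  have Kab: "K4 a b v c" using K sym by (auto simp: K4_def)
  obtain x' y' where xy: "nbrs V E a = {b, v, c, x'}" "nbrs V E b = {a, v, c, y'}" "x' \<noteq> y'" "E x' y'"
    "x' \<notin> {a, b, v, c}" "y' \<notin> {a, b, v, c}"
    using two_low_in_K4[OF low(2,3) Kab] by metis
  have "x' = x" using dx(2,6) xy(1,5) by auto
  have "y' = y" using y(2,6) xy(2,6) by auto
  have V: "v \<in> V" "a \<in> V" "b \<in> V" "c \<in> V" using K by (auto simp: K4_def)
  have nb: "\<not> E d b" "\<not> E x b" "\<not> E y a"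
  proof -
    have "d \<notin> nbrs V E b" "x \<notin> nbrs V E b" "y \<notin> nbrs V E a"
      using dx y xy \<open>d' = d\<close> \<open>x' = x\<close> \<open>y' = y\<close> by auto
    then show "\<not> E d b" "\<not> E x b" "\<not> E y a"
      using dx(7,8) y(7) unfolding in_nbrs by (blast dest: sym)+
  qed
  then have clique: "E d c" "E x c" "E y c" "E d x" "E d y" "E x y"
    using dx(4,9,10) y(4,9) xy(4) \<open>d' = d\<close> \<open>x' = x\<close> \<open>y' = y\<close> by simp_all
  note clique = clique clique[THEN sym]
  have bd: "boundary V E {v, a, b} \<subseteq> {c, d, x, y}"
    using V by (simp add: boundary_eq) (auto simp: dx(1) dx(2) y(2))
  let ?W = "V - {v, a, b}"
  have dist: "v \<noteq> a" "v \<noteq> b" "a \<noteq> b" using K4_distinct[OF K] by auto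
  show False
  proof (rule no_reduction[where k = 3])
    show "simple_graph ?W E" by (rule simple_graph_subset) blast
    show "cut_cyclic ?W E"
    proof (rule cut_cyclic_delete[OF cut_cyclic])
      fix p q assume "p \<in> boundary V E {v, a, b}" "q \<in> boundary V E {v, a, b}" "p \<noteq> q" "\<not> E p q"
      then show "\<exists>T\<subseteq>V - {v, a, b}. core E T \<and> (\<forall>t\<in>T. E p t \<and> E q t)"
        using bd clique by auto
    qed (use V sym in auto)
    have "card {v, a, b} = 3" using dist by simp
    then show "card V = card ?W + 3"
      using V finite_V card_Diff_subset[of "{v, a, b}" V] card_mono[of V "{v, a, b}"] by simp
    have "deg V E v + deg V E a + deg V E b = 12" using low by (simp add: low_def)
    then show "2 * card (adj_pairs ?W E) + 9 * 3 \<le> 2 * card (adj_pairs V E)"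
      using adj_pairs_remove_triangle[of v a b] V K by (simp add: K4_def)
  qed simp
qed

text \<open>
  The outer neighbours \<open>d\<close> of \<open>v\<close> and \<open>x\<close> of \<open>a\<close> are not adjacent to \<open>b\<close>, since otherwise they would be
  \<open>y\<close> or \<open>z\<close>, hence adjacent to both \<open>b\<close> and \<open>c\<close>. By \<open>two_low_in_K4\<close> they are adjacent to \<open>c\<close>. The
  neighbourhood of \<open>{v, a, b}\<close> is \<open>{c, d, x, y, z}\<close> and contains the triangles \<open>cdx\<close> and \<open>cyz\<close>. With
  the edges \<open>dy\<close>, \<open>dz\<close>, \<open>xy\<close> it becomes a clique up to the pair \<open>xz\<close>, whose common neighbours
  \<open>c\<close>, \<open>d\<close>, \<open>y\<close> form a triangle. Deleting \<open>v\<close>, \<open>a\<close>, \<open>b\<close> removes 10 edges, so at least 7 are lost in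
  total, and \<open>7 \<ge> 3 \<sqdot> 9 / 4\<close>.
\<close>

lemma no_quintic_in_two_K4:
  assumes b: "deg V E b = 5" and low: "v \<in> low" "a \<in> low" and K: "K4 v a b c"
    and K': "K4 b c y z" and disj: "{y, z} \<inter> {v, a} = {}"
  shows False
proof -
  have V: "v \<in> V" "a \<in> V" "b \<in> V" "c \<in> V" "y \<in> V" "z \<in> V" using K K' by (auto simp: K4_def)
  have E: "E b v" "E b a" "E b c" "E b y" "E b z" "E y z" "E c y" "E c z"
    using K K' unfolding K4_def by (blast dest: sym)+
  have dist: "distinct [v, a, b, c]" "distinct [b, c, y, z]"
    using K4_distinct K K' by blast+
  have "card {v, a, c, y, z} = 5" using dist disj by auto
  then have Nb: "nbrs V E b = {v, a, c, y, z}"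
    using b V E by (intro nbrs_eqI) (auto simp: in_nbrs)
  obtain d x where dx: "nbrs V E v = {a, b, c, d}" "nbrs V E a = {v, b, c, x}" "d \<noteq> x" "E d x"
    "d \<notin> {v, a, b, c}" "x \<notin> {v, a, b, c}" "d \<in> V" "x \<in> V"
    "E d b \<or> E d c" "E x b \<or> E x c" "\<not> (E d b \<and> E d c)" "\<not> (E x b \<and> E x c)"
    using two_low_in_K4[OF low K] by metis
  have outside: "\<not> E u b" if u: "u \<in> V" "u \<notin> {v, a, b, c}" "\<not> (E u b \<and> E u c)" for u
  proof
    assume ub: "E u b"
    then have "u \<in> nbrs V E b" using u(1) sym[OF ub] by (simp add: in_nbrs)
    then have "u \<in> {y, z}" using u(2) Nb by auto
    then have "E u c" using E(7,8)[THEN sym] by auto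
    then show False using u(3) ub by blast
  qed
  have ndx: "\<not> E d b" "\<not> E x b" using outside dx by blast+
  then have Edx: "E d c" "E x c" using dx(9,10) by blast+
  have ne: "d \<noteq> y" "d \<noteq> z" "x \<noteq> y" "x \<noteq> z" using ndx E(4,5)[THEN sym] by auto
  let ?M = "{(d, y), (y, d), (d, z), (z, d), (x, y), (y, x)}"
  define F where "F = (\<lambda>u w. E u w \<or> (u, w) \<in> ?M)"
  let ?W = "V - {v, a, b}"
  have bd: "boundary V E {v, a, b} \<subseteq> {c, d, x, y, z}"
    using V by (simp add: boundary_eq) (auto simp: dx(1) dx(2) Nb)
  have FE: "E u w \<Longrightarrow> F u w" for u w by (simp add: F_def)
  have symF: "F u w \<Longrightarrow> F w u" for u w by (auto simp: F_def dest: sym)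
  have FF: "F d y" "F d z" "F x y" by (simp_all add: F_def)
  have FF': "F y z" "F c y" "F c z" "F d x" "F d c" "F x c"
    using E Edx dx(4) FE by blast+
  note adj = FF FF' FF[THEN symF] FF'[THEN symF]
  have card3: "card {v, a, b} = 3" using dist by simp
  have sgW: "simple_graph ?W E" by (rule simple_graph_subset) blast
  then have fin: "finite (adj_pairs ?W E)" by (rule simple_graph.finite_adj_pairs)
  show False
  proof (rule no_reduction[where k = 3])
    show "simple_graph ?W F"
    proof
      show "finite ?W" using finite_V by simp
      show "\<And>u w. F u w \<Longrightarrow> F w u" by (rule symF)
      show "\<And>u. \<not> F u u" using irrefl ne by (auto simp: F_def)
    qed
    show "cut_cyclic ?W F"
    proof (rule cut_cyclic_delete[OF cut_cyclic _ FE symF])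
      fix p q assume pq: "p \<in> boundary V E {v, a, b}" "q \<in> boundary V E {v, a, b}" "p \<noteq> q" "\<not> F p q"
      then have "p \<in> {c, d, x, y, z}" "q \<in> {c, d, x, y, z}" using bd by blast+
      then have "{p, q} = {x, z}" using pq(3,4) adj by auto
      then have "\<forall>t\<in>{c, d, y}. F p t \<and> F q t" using adj by (auto simp: doubleton_eq_iff)
      moreover have "core F {c, d, y}" using adj ne dist dx(5) by (auto simp: core_def)
      moreover have "{c, d, y} \<subseteq> ?W" using V dx(5,7) dist disj by auto
      ultimately show "\<exists>T\<subseteq>?W. core F T \<and> (\<forall>t\<in>T. F p t \<and> F q t)" by (intro exI[of _ "{c, d, y}"]) blast
    qed (use V in auto)
    show "card V = card ?W + 3"
      using V finite_V card3 card_Diff_subset[of "{v, a, b}" V] card_mono[of V "{v, a, b}"] by simp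
    have "card (adj_pairs ?W F) \<le> card (adj_pairs ?W E \<union> ?M)"
      using fin by (intro card_mono) (auto simp: adj_pairs_def F_def)
    also have "\<dots> \<le> card (adj_pairs ?W E) + card ?M" by (rule card_Un_le)
    also have "card ?M \<le> 6" using card_length[of "[(d, y), (y, d), (d, z), (z, d), (x, y), (y, x)]"] by simp
    finally have "card (adj_pairs ?W F) \<le> card (adj_pairs ?W E) + 6" by simp
    moreover have "deg V E v + deg V E a + deg V E b = 13" using low b by (simp add: low_def)
    ultimately show "2 * card (adj_pairs ?W F) + 9 * 3 \<le> 2 * card (adj_pairs V E)"
      using adj_pairs_remove_triangle[of v a b] V K by (simp add: K4_def)
  qed simp
qed

lemma mates_sym:
  assumes "v \<in> low" "y \<in> low" "v \<in> mates y"
  shows "y \<in> mates v"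
proof -
  obtain r s where "K4 y v r s" using mates_K4[OF assms(2,3)] by metis
  then show ?thesis using mates_eq[OF assms(1)] K4_swap by blast
qed

lemma mates_subset_nbrs: "mates v \<subseteq> nbrs V E v"
  by (auto simp: mates_def)

text \<open>
  Let \<open>{v, a, u, c}\<close> be the \<open>K4\<close> of \<open>v\<close>. Here \<open>c\<close> has larger degree. If
  \<open>y\<close> differs from \<open>v\<close> and \<open>a\<close>, then the \<open>K4\<close> of \<open>y\<close> contains neither of them, because it would be
  the \<open>K4\<close> of \<open>v\<close> otherwise. As \<open>u\<close> has only five neighbours, it must contain \<open>c\<close>, and \<open>no_quintic_in_two_K4\<close> applies.
\<close>

lemma quintic_payers:
  assumes u: "u \<in> V - low" "deg V E u = 5" and v: "v \<in> low" "u \<in> mates v"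
    and a: "a \<in> low" "a \<in> mates v" and y: "y \<in> low" "u \<in> mates y"
  shows "y \<in> {v, a}"
proof (rule ccontr)
  assume y': "y \<notin> {v, a}"
  obtain p q where pq: "K4 v u p q" "mates v = {u, p, q}" using mates_K4[OF v] by metis
  have "a \<noteq> u" using a u by auto
  then obtain c where K: "K4 v a u c" and Mv: "mates v = {u, a, c}"
  proof (cases "a = p")
    case True
    then show ?thesis using that[of q] pq K4_swap by blast
  next
    case False
    then have "a = q" using a(2) pq(2) \<open>a \<noteq> u\<close> by auto
    moreover have "K4 v q u p" using pq(1) K4_swap by blast
    ultimately show ?thesis using that[of p] pq by auto
  qed
  have "K4 a v u c" "K4 v a c u" using K by (auto intro: K4_swap)
  then have Ma: "mates a = {v, u, c}" and c: "c \<notin> low"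
    using mates_eq[OF a(1)] not_three_low_in_K4[OF v(1) a(1)] by blast+
  obtain r s where rs: "K4 y u r s" "mates y = {u, r, s}" using mates_K4[OF y] by metis
  have yne: "y \<noteq> u" "y \<noteq> c" using y u c by auto
  have "v \<notin> mates y" using mates_sym[OF v(1) y(1)] Mv y' yne by auto
  moreover have "a \<notin> mates y" using mates_sym[OF a(1) y(1)] Ma y' yne by auto
  ultimately have rsva: "{r, s} \<inter> {v, a} = {}" using rs by auto
  have yN: "distinct [y, u, r, s]" "distinct [v, a, u, c]" using K4_distinct rs(1) K by blast+
  have "E u v" "E u a" "E u c" "E u y" "E u r" "E u s"
    using K rs(1) unfolding K4_def by (blast dest: sym)+
  then have sub: "{v, a, c, y, r, s} \<subseteq> nbrs V E u"
    using K rs(1) by (simp add: in_nbrs K4_def)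
  have "c \<in> {r, s}"
  proof (rule ccontr)
    assume "c \<notin> {r, s}"
    then have "card {v, a, c, y, r, s} = 6" using yN rsva y' yne by auto
    then show False using card_mono[OF finite_nbrs sub] u(2) by simp
  qed
  then obtain t where t: "K4 u c y t" "t \<in> {r, s}"
  proof (cases "c = r")
    case True
    have "K4 u r y s" using K4_swap rs(1) by blast
    then show ?thesis using that True by blast
  next
    case False
    then have "c = s" using \<open>c \<in> {r, s}\<close> by auto
    moreover have "K4 u s y r" using K4_swap rs(1) by blast
    ultimately show ?thesis using that by blast
  qed
  have "{y, t} \<inter> {v, a} = {}" using t(2) rsva y' by auto
  then show False using no_quintic_in_two_K4[OF u(2) v(1) a(1) K t(1)] by blast
qed

text \<open>
  What \<open>u\<close> pays to \<open>v\<close>, where \<open>v\<close> has degree 4: the deficit 6 is shared equally by the vertices of larger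
  degree in the \<open>K4\<close> of \<open>v\<close>. There are three of them if no mate of \<open>v\<close> has degree 4, and two
  otherwise.
\<close>

definition K4_payment :: "'a \<Rightarrow> 'a \<Rightarrow> int" where
  "K4_payment v u = (if u \<in> mates v - low then if mates v \<inter> low = {} then 2 else 3 else 0)"

lemma receive_6:
  assumes v: "v \<in> low"
  shows "(\<Sum>u\<in>V - low. K4_payment v u) = 6"
proof -
  obtain a b c where K: "K4 v a b c" using low_K4_ex[OF v] by metis
  have M: "mates v = {a, b, c}" by (rule mates_eq[OF v K])
  have card3: "card (mates v) = 3" using K4_distinct[OF K] by (simp add: M)
  have sub: "mates v - low \<subseteq> V - low" using K by (auto simp: M K4_def)
  define k :: int where "k = (if mates v \<inter> low = {} then 2 else 3)"
  have "(\<Sum>u\<in>V - low. K4_payment v u) = (\<Sum>u\<in>V - low. if u \<in> mates v - low then k else 0)"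
    unfolding K4_payment_def k_def ..
  also have "\<dots> = k * int (card (mates v - low))"
    using finite_V sub by (intro sum_if_mem) auto
  also have "\<dots> = 6"
  proof (cases "mates v \<inter> low = {}")
    case True
    then have "mates v - low = mates v" by auto
    then show ?thesis using True card3 by (simp add: k_def)
  next
    case False
    have "x = y" if "x \<in> mates v \<inter> low" "y \<in> mates v \<inter> low" for x y
    proof (rule ccontr)
      assume "x \<noteq> y"
      obtain r s where rs: "K4 v x r s" "mates v = {x, r, s}" using mates_K4[OF v] \<open>x \<in> _\<close> by blast
      then have "y \<in> {r, s}" using that(2) \<open>x \<noteq> y\<close> by auto
      moreover have "K4 v x s r" using rs(1) K4_swap by blast
      ultimately show False
        using not_three_low_in_K4[OF v] rs(1) that by blast
    qed
    then obtain x where x: "mates v \<inter> low = {x}" using False by blast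
    then have "mates v - low = mates v - {x}" by auto
    moreover have "x \<in> mates v" using x by auto
    ultimately have "card (mates v - low) = 2" using card3 by simp
    then show ?thesis using False by (simp add: k_def)
  qed
  finally show ?thesis .
qed

text \<open>
  A vertex of degree \<open>d \<ge> 6\<close> can pay 3 to each neighbour. A vertex \<open>u\<close> of degree 5 has 6 to spend. Either
  someone requests 3 from it, in which case only two vertices request anything, or all requests are
  2. In the latter case \<open>u\<close> has two neighbours of larger degree in the \<open>K4\<close> of a requesting vertex, so
  there are at most three requests.
\<close>

lemma pay_bound:
  assumes u: "u \<in> V - low"
  shows "(\<Sum>v\<in>low. K4_payment v u) \<le> 12 * int (deg V E u) - 54"
proof -
  define P where "P = {v \<in> low. u \<in> mates v}"
  have finlow: "finite low" using finite_V by (simp add: low_def)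
  have P: "P \<subseteq> low" by (auto simp: P_def)
  then have finP: "finite P" using finlow finite_subset by blast
  have PN: "P \<subseteq> nbrs V E u"
  proof
    fix v assume v: "v \<in> P"
    then have "u \<in> nbrs V E v" using mates_subset_nbrs by (auto simp: P_def)
    moreover have "v \<in> V" using v by (auto simp: P_def low_def)
    ultimately show "v \<in> nbrs V E u" using nbrs_commute u by blast
  qed
  have sum_le: "(\<Sum>v\<in>low. K4_payment v u) \<le> k * int (card P)"
    if "\<And>v. v \<in> P \<Longrightarrow> K4_payment v u \<le> k" for k
  proof -
    have "(\<Sum>v\<in>low. K4_payment v u) \<le> (\<Sum>v\<in>low. if v \<in> P then k else 0)"
      using that u by (intro sum_mono) (auto simp: K4_payment_def P_def)
    then show ?thesis using sum_if_mem[OF finlow P] by simp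
  qed
  have pay3: "K4_payment v u \<le> 3" for v by (simp add: K4_payment_def)
  have d5: "5 \<le> deg V E u" using deg_ge_4[of u] u by (auto simp: low_def)
  show ?thesis
  proof (cases "6 \<le> deg V E u")
    case True
    have "card P \<le> deg V E u" using PN by (intro card_mono) auto
    then show ?thesis using sum_le[of 3] pay3 True by force
  next
    case False
    then have deg: "deg V E u = 5" using d5 by simp
    show ?thesis
    proof (cases "\<exists>v\<in>P. mates v \<inter> low \<noteq> {}")
      case True
      then obtain v a where va: "v \<in> low" "u \<in> mates v" "a \<in> low" "a \<in> mates v" by (auto simp: P_def)
      have "P \<subseteq> {v, a}" using quintic_payers[OF u deg va] by (auto simp: P_def)
      then have "card P \<le> card {v, a}" by (intro card_mono) auto
      also have "\<dots> \<le> 2" by (simp add: card_insert_if)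
      finally show ?thesis using sum_le[of 3] pay3 deg by force
    next
      case none: False
      then have "K4_payment v u \<le> 2" if "v \<in> P" for v using that by (auto simp: K4_payment_def)
      then have le: "(\<Sum>v\<in>low. K4_payment v u) \<le> 2 * int (card P)" by (rule sum_le)
      have "card P \<le> 3"
      proof (cases "P = {}")
        case False
        then obtain v where v: "v \<in> low" "u \<in> mates v" "v \<in> P" by (auto simp: P_def)
        obtain p q where pq: "K4 v u p q" "mates v = {u, p, q}" using mates_K4[OF v(1,2)] by metis
        have "p \<notin> low" "q \<notin> low" using none v(3) pq(2) by auto
        then have "P \<subseteq> nbrs V E u - {p, q}" using PN P by blast
        then have "card P \<le> card (nbrs V E u - {p, q})" by (intro card_mono) auto
        also have "\<dots> = 3"
          using pq(1) K4_distinct[OF pq(1)] deg by (subst card_Diff_subset) (auto simp: K4_def in_nbrs)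
        finally show ?thesis .
      qed simp
      then show ?thesis using le deg by simp
    qed
  qed
qed

text \<open>
  The charge of a vertex is 12 times the excess of its degree over \<open>9/2\<close>.
\<close>

lemma no_minimal_counterexample: False
proof -
  have "0 \<le> (\<Sum>v\<in>V. 12 * int (deg V E v) - 54)"
  proof (rule discharging[OF finite_V, where L = low and w = K4_payment])
    show "low \<subseteq> V" by (auto simp: low_def)
    show "0 \<le> 12 * int (deg V E v) - 54 + (\<Sum>u\<in>V - low. K4_payment v u)" if "v \<in> low" for v
      using receive_6[OF that] that by (simp add: low_def)
  qed (rule pay_bound)
  also have "\<dots> = 12 * int (\<Sum>v\<in>V. deg V E v) - 54 * int (card V)"
    by (simp add: sum_subtractf sum_distrib_left)
  finally show False using sum_deg counterexample by simp
qed

end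

text \<open>
  The degree sum bound that amounts to \<open>e \<ge> 9 n / 4 - 15 / 4\<close>, as the pairs count edges twice.
\<close>

lemma edge_bound_cut_cyclic:
  assumes "simple_graph V E" "cut_cyclic V E"
  shows "9 * card V \<le> 2 * card (adj_pairs V E) + 15"
  using assms
proof (induction "card V" arbitrary: V E rule: less_induct)
  case less
  show ?case
  proof (rule ccontr)
    assume "\<not> ?thesis"
    then interpret minimal_counterexample V E
      using less.prems(2) less.hyps
      by (intro minimal_counterexample.intro less.prems(1) minimal_counterexample_axioms.intro) simp_all
    show False by (rule no_minimal_counterexample)
  qed
qed

section \<open>Transfer to digraphs and edge sets\<close>

text \<open>
  The two cyclic neighbours \<open>h j\<close> and \<open>h k\<close> of \<open>h i\<close> are distinct because there are at least three
  indices.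
\<close>

lemma core_of_cyclic_sequence:
  assumes inj: "inj_on h {..<n}" and n: "3 \<le> n"
    and step: "\<And>i. i < n \<Longrightarrow> E (h i) (h (if Suc i = n then 0 else Suc i))"
    and sym: "\<And>u v. E u v \<Longrightarrow> E v u"
  shows "core E (h ` {..<n})"
proof -
  have "\<exists>x\<in>h ` {..<n}. \<exists>y\<in>h ` {..<n}. x \<noteq> y \<and> E (h i) x \<and> E (h i) y" if i: "i < n" for i
  proof -
    define j where "j = (if Suc i = n then 0 else Suc i)"
    define k where "k = (if i = 0 then n - 1 else i - 1)"
    have jk: "j < n" "k < n" "j \<noteq> k" "(if Suc k = n then 0 else Suc k) = i"
      using i n by (auto simp: j_def k_def)
    have "E (h i) (h j)" using step[OF i] by (simp add: j_def)
    moreover have "E (h i) (h k)" using step[OF jk(2)] sym jk(4) by simp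
    moreover have "h j \<noteq> h k" using inj jk by (auto simp: inj_on_def)
    ultimately show ?thesis using jk by blast
  qed
  then show ?thesis using n by (auto simp: core_def lessThan_empty_iff)
qed

lemma (in pre_digraph) cas_nth:
  assumes "cas u p v"
  shows "Suc i < length p \<Longrightarrow> head G (p ! i) = tail G (p ! Suc i)"
    and "p \<noteq> [] \<Longrightarrow> tail G (p ! 0) = u" and "p \<noteq> [] \<Longrightarrow> head G (last p) = v"
proof -
  show "Suc i < length p \<Longrightarrow> head G (p ! i) = tail G (p ! Suc i)" using assms
  proof (induction p arbitrary: u i)
    case (Cons e p)
    then show ?case by (cases i; cases p) auto
  qed simp
  show "p \<noteq> [] \<Longrightarrow> tail G (p ! 0) = u" using assms by (cases p) auto
  show "p \<noteq> [] \<Longrightarrow> head G (last p) = v" using assms by (induction p arbitrary: u) auto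
qed

lemma ucycle_imp_core:
  assumes "graph G" and "has_ucycle (G \<restriction> S)"
  shows "\<exists>T \<subseteq> S. core (dominates G) T"
proof -
  interpret graph G by fact
  from assms(2) obtain p u where p: "pre_digraph.awalk (G \<restriction> S) u p u"
    "distinct (tl (pre_digraph.awalk_verts (G \<restriction> S) u p))" "3 \<le> length p"
    by (auto simp: has_ucycle_def pre_digraph.cycle_def)
  define n where "n = length p"
  define h where "h i = head G (p ! i)" for i
  have arcs: "set p \<subseteq> {e \<in> arcs G. tail G e \<in> S \<and> head G e \<in> S}"
    and cas: "pre_digraph.cas (G \<restriction> S) u p u"
    using p(1) by (auto simp: pre_digraph.awalk_def)
  note nth = pre_digraph.cas_nth[OF cas, simplified]
  have "tl (pre_digraph.awalk_verts (G \<restriction> S) u p) = map (head G) p"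
    using pre_digraph.awalk_verts_conv'[OF cas] p(3) by auto
  with p(2) have "distinct (map (head G) p)" by simp
  then have "inj_on h {..<n}"
    by (auto simp: inj_on_def h_def n_def distinct_conv_nth)
  moreover have "dominates G (h i) (h (if Suc i = n then 0 else Suc i))" if "i < n" for i
  proof (cases "Suc i = n")
    case True
    then have "i = length p - 1" and ne: "p \<noteq> []" using p(3) by (auto simp: n_def)
    then have "h i = tail G (p ! 0)" using nth(2,3) by (simp add: h_def last_conv_nth)
    moreover have "p ! 0 \<in> set p" using ne by simp
    then have "p ! 0 \<in> arcs G" using arcs by blast
    ultimately show ?thesis using True by (auto simp: h_def arcs_ends_conv)
  next
    case False
    then have *: "Suc i < length p" using that by (auto simp: n_def)
    then have "h i = tail G (p ! Suc i)" using nth(1) by (auto simp: h_def)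
    moreover have "p ! Suc i \<in> arcs G" using arcs * nth_mem by blast
    ultimately show ?thesis using False by (auto simp: h_def arcs_ends_conv)
  qed
  moreover have "dominates G v u" if "dominates G u v" for u v
    using that sym_arcs arcs_ends_symmetric by metis
  ultimately have "core (dominates G) (h ` {..<n})"
    using p(3) by (intro core_of_cyclic_sequence) (auto simp: n_def)
  moreover have "h ` {..<n} \<subseteq> S"
    using subsetD[OF arcs, OF nth_mem] by (auto simp: h_def n_def)
  ultimately show ?thesis by blast
qed

lemma separated_imp_not_connected:
  assumes "graph G" and "separated (verts G) (dominates G) A B"
  shows "\<not> Digraph_Component.connected (G \<restriction> (A \<union> B))"
proof
  interpret graph G by fact
  assume c: "Digraph_Component.connected (G \<restriction> (A \<union> B))"
  let ?H = "G \<restriction> (A \<union> B)"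
  from assms(2) obtain a b where ab: "a \<in> A" "b \<in> B" by (auto simp: separated_def)
  have "(a, b) \<in> rtrancl_on (A \<union> B) ((arcs_ends ?H)\<^sup>s)"
    using c ab by (auto simp: connected_conv)
  then have "b \<in> A"
  proof (induction rule: rtrancl_on_induct)
    case base
    then show ?case using ab by simp
  next
    case (step y z)
    then have "dominates G y z \<or> dominates G z y"
      by (auto simp: symcl_def dest: dominates_induce_subgraphD)
    then have "dominates G y z" using sym_arcs arcs_ends_symmetric by metis
    then show ?case using step assms(2) by (auto simp: separated_def)
  qed
  then show False using ab assms(2) by (auto simp: separated_def)
qed

lemma graph_imp_simple_graph:
  assumes "graph G"
  shows "simple_graph (verts G) (dominates G)"
proof -
  interpret graph G by fact
  show ?thesis
    using arcs_ends_symmetric[OF sym_arcs] adj_not_same by unfold_locales auto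
qed

lemma card_adj_pairs_le_edges:
  assumes "graph G"
  shows "card (adj_pairs (verts G) (dominates G)) \<le> 2 * card (uedges G)"
proof -
  interpret graph G by fact
  let ?P = "adj_pairs (verts G) (dominates G)"
  let ?f = "\<lambda>p. {fst p, snd p}"
  have fin: "finite ?P"
    by (rule finite_subset[of _ "verts G \<times> verts G"]) (auto simp: adj_pairs_def)
  have sub: "?f ` ?P \<subseteq> uedges G"
    unfolding adj_pairs_def uedges_def by fastforce
  have "uedges G \<subseteq> Pow (verts G)"
    using adj_in_verts unfolding uedges_def by blast
  then have fin': "finite (uedges G)" using finite_subset finite_verts by blast
  have "card ?P \<le> 2 * card (?f ` ?P)"
  proof -
    have "card ?P = (\<Sum>e\<in>?f ` ?P. card {p \<in> ?P. ?f p = e})"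
      using sum.image_gen[OF fin, of "\<lambda>_. 1::nat" ?f] by (simp only: sum_constant mult_1_right of_nat_id)
    also have "\<dots> \<le> (\<Sum>e\<in>?f ` ?P. 2)"
    proof (rule sum_mono)
      fix e assume "e \<in> ?f ` ?P"
      then obtain q where e: "e = {fst q, snd q}" by blast
      have "{p \<in> ?P. ?f p = e} \<subseteq> {q, (snd q, fst q)}"
        unfolding e by (clarsimp simp: doubleton_eq_iff)
      then have "card {p \<in> ?P. ?f p = e} \<le> card {q, (snd q, fst q)}"
        by (rule card_mono[rotated]) simp
      also have "\<dots> \<le> 2" by (simp add: card_insert_if)
      finally show "card {p \<in> ?P. ?f p = e} \<le> 2" .
    qed
    also have "\<dots> = 2 * card (?f ` ?P)" by (simp only: sum_constant mult.commute of_nat_id)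
    finally show ?thesis .
  qed
  also have "card (?f ` ?P) \<le> card (uedges G)" using card_mono[OF fin' sub] .
  finally show ?thesis by simp
qed

lemma no_forest_cut_imp_cut_cyclic:
  assumes "graph G" and "\<nexists>S. forest_cut G S"
  shows "cut_cyclic (verts G) (dominates G)"
  unfolding cut_cyclic_def
proof (intro allI impI)
  fix A B assume sep: "separated (verts G) (dominates G) A B"
  then have "verts G - (verts G - (A \<union> B)) = A \<union> B" by (auto simp: separated_def)
  then have "vertex_cut G (verts G - (A \<union> B))"
    using separated_imp_not_connected[OF assms(1) sep] sep
    by (auto simp: vertex_cut_def separated_def)
  then have "has_ucycle (G \<restriction> (verts G - (A \<union> B)))"
    using assms(2) by (auto simp: forest_cut_def uforest_def)
  from ucycle_imp_core[OF assms(1) this]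
  show "\<exists>T\<subseteq>verts G - A - B. core (dominates G) T" by blast
qed

lemma k_connected_imp_small_boundary:
  assumes "graph G" and "k_connected k G" and X: "X \<subseteq> verts G" "X \<noteq> {}"
    and small: "card (boundary (verts G) (dominates G) X) < k"
  shows "verts G = X \<union> boundary (verts G) (dominates G) X"
proof (rule ccontr)
  let ?N = "boundary (verts G) (dominates G) X"
  interpret graph G by fact
  assume "verts G \<noteq> X \<union> ?N"
  then have "separated (verts G) (dominates G) X (verts G - X - ?N)"
    using X by (auto simp: separated_def boundary_def)
  moreover have "X \<union> (verts G - X - ?N) = verts G - ?N"
    using X by (auto simp: boundary_def)
  ultimately have "\<not> Digraph_Component.connected (G \<restriction> (verts G - ?N))"
    using separated_imp_not_connected[OF assms(1)] by metis
  then show False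
    using assms(2) small by (auto simp: k_connected_def boundary_def)
qed

lemma k_cyclic_imp_core:
  assumes "graph G" and "k_cyclic k G" and "X \<subseteq> verts G" "X \<noteq> {}" "card X \<le> k"
    and "verts G \<noteq> X \<union> boundary (verts G) (dominates G) X"
  shows "\<exists>T \<subseteq> boundary (verts G) (dominates G) X. core (dominates G) T"
proof -
  interpret G: simple_graph "verts G" "dominates G" using assms(1) by (rule graph_imp_simple_graph)
  have eq: "neighborhood G X = boundary (verts G) (dominates G) X"
    using G.sym by (auto simp: neighborhood_def boundary_def)
  have "\<not> dominating G X"
    using assms(3,6) G.sym unfolding dominating_def boundary_def by blast
  then have "has_ucycle (G \<restriction> neighborhood G X)"
    using assms(2-5) by (auto simp: k_cyclic_def)
  from ucycle_imp_core[OF assms(1) this] show ?thesis by (simp add: eq)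
qed

theorem theorem3:
  fixes G :: "('a, 'b) pre_digraph" and n e :: nat
  assumes "graph G" and "n = card (verts G)" and "e = card (uedges G)"
  shows "(Digraph_Component.connected G \<and> \<not> (\<exists>S. forest_cut G S) \<longrightarrow>
            real e \<ge> 9 / 4 * real n - 15 / 4) \<and>
         (k_connected 3 G \<and> k_cyclic 1 G \<and> n \<ge> 6 \<longrightarrow> real e \<ge> 15 / 8 * real n) \<and>
         (k_connected 3 G \<and> k_cyclic 2 G \<and> n \<ge> 6 \<longrightarrow> real e \<ge> 2 * real n)"
proof (intro conjI impI; elim conjE)
  let ?E = "dominates G"
  have pairs: "card (adj_pairs (verts G) ?E) \<le> 2 * e"
    using card_adj_pairs_le_edges[OF assms(1)] assms(3) by simp
  have three_connected: "three_connected (verts G) ?E k"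
    if "k_connected 3 G" "k_cyclic k G" "6 \<le> n" "1 \<le> k" for k
    using that assms(2) k_connected_imp_small_boundary[OF assms(1) that(1)]
      k_cyclic_imp_core[OF assms(1) that(2)]
    by (intro three_connected.intro graph_imp_simple_graph[OF assms(1)]
        three_connected_axioms.intro) auto
  {
    assume "\<nexists>S. forest_cut G S"
    then have "9 * n \<le> 2 * card (adj_pairs (verts G) ?E) + 15"
      unfolding assms(2)
      by (intro edge_bound_cut_cyclic graph_imp_simple_graph no_forest_cut_imp_cut_cyclic assms(1))
    then have "real (9 * n) \<le> real (4 * e + 15)" using pairs by linarith
    then show "9 / 4 * real n - 15 / 4 \<le> real e" by simp
  next
    assume "k_connected 3 G" "k_cyclic 1 G" "6 \<le> n"
    then interpret three_connected "verts G" ?E 1 by (intro three_connected) auto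
    have "real (15 * n) \<le> real (8 * e)" using edge_bound_1_cyclic pairs assms(2) by linarith
    then show "15 / 8 * real n \<le> real e" by simp
  next
    assume "k_connected 3 G" "k_cyclic 2 G" "6 \<le> n"
    then interpret three_connected "verts G" ?E 2 by (intro three_connected) auto
    have "real (4 * n) \<le> real (2 * e)" using edge_bound_2_cyclic pairs assms(2) by linarith
    then show "2 * real n \<le> real e" by simp
  }
qed

end
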